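(* Let $G$ be an infinite finitely generated virtually nilpotent group, considered as a structure $(G,\cdot,\dots)$ in an arbitrary first-order language expanding the language of groups, and let $G^*$ be a sufficiently saturated elementary extension. Then the connected component $G^{*0}$ exists, it is a divisible group, and $G^{*0}=\bigcap_{n\in\mathbb{N}}\langle\{g^n : g\in G^*\}\rangle$.
   Context: $G^*$ is an elementary extension of $(G,\cdot,\dots)$ that is $\kappa$-saturated and $\kappa$-strongly homogeneous for a sufficiently large cardinal $\kappa$; a set is small if it has cardinality $<\kappa$. For small $A\subseteq G^*$, $G^{*0}_A$ is the intersection of all $A$-definable subgroups of finite index in $G^*$; $G^{*0}$ exists if $G^{*0}_A=G^{*0}_\emptyset$ for all small $A$, and $G^{*0}$ denotes this group. A group $H$ is divisible if for every $h\in H$ and $n\ge 1$ there is $x\in H$ with $x^n=h$. A group is virtually nilpotent if it has a nilpotent subgroup of finite index. *)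

theory Defs
  imports "HOL-Algebra.Generated_Groups"
begin

unbundle cardinal_syntax

section \<open>First-order languages and structures\<close>

record ('f, 'r) language =
  fun_syms :: "'f set"
  rel_syms :: "'r set"
  fun_arity :: "'f \<Rightarrow> nat"
  rel_arity :: "'r \<Rightarrow> nat"

record ('a, 'f, 'r) fo_struct =
  universe :: "'a set"
  fun_interp :: "'f \<Rightarrow> 'a list \<Rightarrow> 'a"
  rel_interp :: "'r \<Rightarrow> 'a list \<Rightarrow> bool"

definition is_structure :: "('f, 'r) language \<Rightarrow> ('a, 'f, 'r) fo_struct \<Rightarrow> bool" where
  "is_structure L M \<longleftrightarrow>
     universe M \<noteq> {} \<and>
     (\<forall>f \<in> fun_syms L. \<forall>xs. set xs \<subseteq> universe M \<and> length xs = fun_arity L f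
        \<longrightarrow> fun_interp M f xs \<in> universe M)"

datatype 'f fo_term = Variable nat | Apply 'f "'f fo_term list"

datatype ('f, 'r) fo_formula =
    Equal "'f fo_term" "'f fo_term"
  | Atom 'r "'f fo_term list"
  | Neg "('f, 'r) fo_formula"
  | Conj "('f, 'r) fo_formula" "('f, 'r) fo_formula"
  | Exists nat "('f, 'r) fo_formula"

fun term_in :: "('f, 'r) language \<Rightarrow> 'f fo_term \<Rightarrow> bool" where
  "term_in L (Variable i) \<longleftrightarrow> True"
| "term_in L (Apply f ts) \<longleftrightarrow>
     f \<in> fun_syms L \<and> length ts = fun_arity L f \<and> (\<forall>t \<in> set ts. term_in L t)"

fun formula_in :: "('f, 'r) language \<Rightarrow> ('f, 'r) fo_formula \<Rightarrow> bool" where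
  "formula_in L (Equal s t) \<longleftrightarrow> term_in L s \<and> term_in L t"
| "formula_in L (Atom r ts) \<longleftrightarrow>
     r \<in> rel_syms L \<and> length ts = rel_arity L r \<and> (\<forall>t \<in> set ts. term_in L t)"
| "formula_in L (Neg \<phi>) \<longleftrightarrow> formula_in L \<phi>"
| "formula_in L (Conj \<phi> \<psi>) \<longleftrightarrow> formula_in L \<phi> \<and> formula_in L \<psi>"
| "formula_in L (Exists i \<phi>) \<longleftrightarrow> formula_in L \<phi>"

fun term_vars :: "'f fo_term \<Rightarrow> nat set" where
  "term_vars (Variable i) = {i}"
| "term_vars (Apply f ts) = (\<Union>t \<in> set ts. term_vars t)"

fun free_vars :: "('f, 'r) fo_formula \<Rightarrow> nat set" where
  "free_vars (Equal s t) = term_vars s \<union> term_vars t"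
| "free_vars (Atom r ts) = (\<Union>t \<in> set ts. term_vars t)"
| "free_vars (Neg \<phi>) = free_vars \<phi>"
| "free_vars (Conj \<phi> \<psi>) = free_vars \<phi> \<union> free_vars \<psi>"
| "free_vars (Exists i \<phi>) = free_vars \<phi> - {i}"

fun eval_term :: "('a, 'f, 'r) fo_struct \<Rightarrow> (nat \<Rightarrow> 'a) \<Rightarrow> 'f fo_term \<Rightarrow> 'a" where
  "eval_term M v (Variable i) = v i"
| "eval_term M v (Apply f ts) = fun_interp M f (map (eval_term M v) ts)"

fun sat :: "('a, 'f, 'r) fo_struct \<Rightarrow> (nat \<Rightarrow> 'a) \<Rightarrow> ('f, 'r) fo_formula \<Rightarrow> bool" where
  "sat M v (Equal s t) \<longleftrightarrow> eval_term M v s = eval_term M v t"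
| "sat M v (Atom r ts) \<longleftrightarrow> rel_interp M r (map (eval_term M v) ts)"
| "sat M v (Neg \<phi>) \<longleftrightarrow> \<not> sat M v \<phi>"
| "sat M v (Conj \<phi> \<psi>) \<longleftrightarrow> sat M v \<phi> \<and> sat M v \<psi>"
| "sat M v (Exists i \<phi>) \<longleftrightarrow> (\<exists>x \<in> universe M. sat M (v(i := x)) \<phi>)"

definition substructure ::
    "('f, 'r) language \<Rightarrow> ('a, 'f, 'r) fo_struct \<Rightarrow> ('a, 'f, 'r) fo_struct \<Rightarrow> bool" where
  "substructure L M N \<longleftrightarrow>
     is_structure L M \<and> is_structure L N \<and> universe M \<subseteq> universe N \<and>
     (\<forall>f \<in> fun_syms L. \<forall>xs. set xs \<subseteq> universe M \<and> length xs = fun_arity L f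
        \<longrightarrow> fun_interp N f xs = fun_interp M f xs) \<and>
     (\<forall>r \<in> rel_syms L. \<forall>xs. set xs \<subseteq> universe M \<and> length xs = rel_arity L r
        \<longrightarrow> rel_interp N r xs = rel_interp M r xs)"

definition elementary_extension ::
    "('f, 'r) language \<Rightarrow> ('a, 'f, 'r) fo_struct \<Rightarrow> ('a, 'f, 'r) fo_struct \<Rightarrow> bool" where
  "elementary_extension L M N \<longleftrightarrow>
     substructure L M N \<and>
     (\<forall>\<phi> v. formula_in L \<phi> \<and> range v \<subseteq> universe M \<longrightarrow> (sat M v \<phi> \<longleftrightarrow> sat N v \<phi>))"

section \<open>Definable sets, saturation and homogeneity\<close>

text \<open>
  A formula \<open>\<phi>(x, a\<^sub>1, \<dots>, a\<^sub>k)\<close> with parameters from \<open>A\<close> is encoded as a pair \<open>(\<phi>, v)\<close>: the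
  distinguished free variable \<open>x\<close> has index 0, and the valuation \<open>v\<close> sends every other free variable
  to a parameter.  The value of \<open>v\<close> at variables that are not free in \<open>\<phi>\<close> is irrelevant, so with
  \<open>A = {}\<close> these are exactly the parameter-free formulas in the variable \<open>x\<close>.
\<close>

definition formulas_over ::
    "('f, 'r) language \<Rightarrow> 'a set \<Rightarrow> (('f, 'r) fo_formula \<times> (nat \<Rightarrow> 'a)) set" where
  "formulas_over L A = {(\<phi>, v). formula_in L \<phi> \<and> v ` (free_vars \<phi> - {0}) \<subseteq> A}"

definition satisfies ::
    "('a, 'f, 'r) fo_struct \<Rightarrow> 'a \<Rightarrow> ('f, 'r) fo_formula \<times> (nat \<Rightarrow> 'a) \<Rightarrow> bool" where
  "satisfies M x p \<longleftrightarrow> sat M ((snd p)(0 := x)) (fst p)"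

definition definable ::
    "('f, 'r) language \<Rightarrow> ('a, 'f, 'r) fo_struct \<Rightarrow> 'a set \<Rightarrow> 'a set \<Rightarrow> bool" where
  "definable L M A X \<longleftrightarrow> (\<exists>p \<in> formulas_over L A. X = {x \<in> universe M. satisfies M x p})"

definition is_type ::
    "('f, 'r) language \<Rightarrow> ('a, 'f, 'r) fo_struct \<Rightarrow> 'a set
      \<Rightarrow> (('f, 'r) fo_formula \<times> (nat \<Rightarrow> 'a)) set \<Rightarrow> bool" where
  "is_type L M A \<Gamma> \<longleftrightarrow>
     \<Gamma> \<subseteq> formulas_over L A \<and>
     (\<forall>\<Delta> \<subseteq> \<Gamma>. finite \<Delta> \<longrightarrow> (\<exists>x \<in> universe M. \<forall>p \<in> \<Delta>. satisfies M x p))"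

definition small :: "'k rel \<Rightarrow> 'a set \<Rightarrow> bool" where
  "small \<kappa> A \<longleftrightarrow> |A| <o \<kappa>"

definition saturated ::
    "('f, 'r) language \<Rightarrow> 'k rel \<Rightarrow> ('a, 'f, 'r) fo_struct \<Rightarrow> bool" where
  "saturated L \<kappa> M \<longleftrightarrow>
     (\<forall>A \<Gamma>. A \<subseteq> universe M \<and> small \<kappa> A \<and> is_type L M A \<Gamma>
        \<longrightarrow> (\<exists>x \<in> universe M. \<forall>p \<in> \<Gamma>. satisfies M x p))"

definition automorphism ::
    "('f, 'r) language \<Rightarrow> ('a, 'f, 'r) fo_struct \<Rightarrow> ('a \<Rightarrow> 'a) \<Rightarrow> bool" where
  "automorphism L M \<sigma> \<longleftrightarrow>
     bij_betw \<sigma> (universe M) (universe M) \<and>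
     (\<forall>f \<in> fun_syms L. \<forall>xs. set xs \<subseteq> universe M \<and> length xs = fun_arity L f
        \<longrightarrow> \<sigma> (fun_interp M f xs) = fun_interp M f (map \<sigma> xs)) \<and>
     (\<forall>r \<in> rel_syms L. \<forall>xs. set xs \<subseteq> universe M \<and> length xs = rel_arity L r
        \<longrightarrow> (rel_interp M r xs \<longleftrightarrow> rel_interp M r (map \<sigma> xs)))"

definition partial_elementary ::
    "('f, 'r) language \<Rightarrow> ('a, 'f, 'r) fo_struct \<Rightarrow> 'a set \<Rightarrow> ('a \<Rightarrow> 'a) \<Rightarrow> bool" where
  "partial_elementary L M A h \<longleftrightarrow>
     A \<subseteq> universe M \<and> h ` A \<subseteq> universe M \<and>
     (\<forall>\<phi> v. formula_in L \<phi> \<and> v ` free_vars \<phi> \<subseteq> A \<longrightarrow> (sat M v \<phi> \<longleftrightarrow> sat M (h \<circ> v) \<phi>))"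

definition strongly_homogeneous ::
    "('f, 'r) language \<Rightarrow> 'k rel \<Rightarrow> ('a, 'f, 'r) fo_struct \<Rightarrow> bool" where
  "strongly_homogeneous L \<kappa> M \<longleftrightarrow>
     (\<forall>A h. small \<kappa> A \<and> partial_elementary L M A h
        \<longrightarrow> (\<exists>\<sigma>. automorphism L M \<sigma> \<and> (\<forall>a \<in> A. \<sigma> a = h a)))"

text \<open>
  The lower bound imposed on \<open>\<kappa>\<close> is \<open>\<kappa> > |L| + \<aleph>\<^sub>0\<close>; any larger threshold gives a weaker statement.
\<close>

definition sufficiently_large :: "('f, 'r) language \<Rightarrow> 'k rel \<Rightarrow> bool" where
  "sufficiently_large L \<kappa> \<longleftrightarrow>
     Card_order \<kappa> \<and> natLeq <o \<kappa> \<and> |fun_syms L| <o \<kappa> \<and> |rel_syms L| <o \<kappa>"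

section \<open>Groups\<close>

definition expands_group_language :: "('f, 'r) language \<Rightarrow> 'f \<Rightarrow> bool" where
  "expands_group_language L m \<longleftrightarrow> m \<in> fun_syms L \<and> fun_arity L m = 2"

text \<open>
  Only a symbol for multiplication is required of the language (symbols for the unit and the inverse
  may or may not be present), so the unit of the underlying group is recovered from the product.
\<close>

definition group_of :: "'f \<Rightarrow> ('a, 'f, 'r) fo_struct \<Rightarrow> 'a monoid" where
  "group_of m M =
     \<lparr>carrier = universe M,
      monoid.mult = (\<lambda>x y. fun_interp M m [x, y]),
      one = (THE e. e \<in> universe M \<and>
               (\<forall>x \<in> universe M. fun_interp M m [e, x] = x \<and> fun_interp M m [x, e] = x))\<rparr>"

definition finite_index_subgroup :: "('a, 'b) monoid_scheme \<Rightarrow> 'a set \<Rightarrow> bool" where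
  "finite_index_subgroup G H \<longleftrightarrow> subgroup H G \<and> finite (rcosets\<^bsub>G\<^esub> H)"

definition finitely_generated :: "('a, 'b) monoid_scheme \<Rightarrow> bool" where
  "finitely_generated G \<longleftrightarrow> (\<exists>S. finite S \<and> S \<subseteq> carrier G \<and> generate G S = carrier G)"

fun lower_central :: "('a, 'b) monoid_scheme \<Rightarrow> nat \<Rightarrow> 'a set" where
  "lower_central G 0 = carrier G"
| "lower_central G (Suc n) =
     generate G {x \<otimes>\<^bsub>G\<^esub> y \<otimes>\<^bsub>G\<^esub> inv\<^bsub>G\<^esub> x \<otimes>\<^bsub>G\<^esub> inv\<^bsub>G\<^esub> y | x y.
       x \<in> lower_central G n \<and> y \<in> carrier G}"

definition nilpotent_group :: "('a, 'b) monoid_scheme \<Rightarrow> bool" where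
  "nilpotent_group G \<longleftrightarrow> group G \<and> (\<exists>n. lower_central G n = {\<one>\<^bsub>G\<^esub>})"

definition virtually_nilpotent :: "('a, 'b) monoid_scheme \<Rightarrow> bool" where
  "virtually_nilpotent G \<longleftrightarrow> (\<exists>H. finite_index_subgroup G H \<and> nilpotent_group (G\<lparr>carrier := H\<rparr>))"

definition divisible_group :: "('a, 'b) monoid_scheme \<Rightarrow> bool" where
  "divisible_group H \<longleftrightarrow>
     group H \<and> (\<forall>h \<in> carrier H. \<forall>n::nat. 1 \<le> n \<longrightarrow> (\<exists>x \<in> carrier H. x [^]\<^bsub>H\<^esub> n = h))"

definition power_subgroup :: "('a, 'b) monoid_scheme \<Rightarrow> nat \<Rightarrow> 'a set" where
  "power_subgroup G n = generate G {g [^]\<^bsub>G\<^esub> n | g. g \<in> carrier G}"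

section \<open>The connected component\<close>

definition connected_component_over ::
    "('f, 'r) language \<Rightarrow> 'f \<Rightarrow> ('a, 'f, 'r) fo_struct \<Rightarrow> 'a set \<Rightarrow> 'a set" where
  "connected_component_over L m M A =
     \<Inter>{H. finite_index_subgroup (group_of m M) H \<and> definable L M A H}"

definition connected_component_exists ::
    "('f, 'r) language \<Rightarrow> 'f \<Rightarrow> 'k rel \<Rightarrow> ('a, 'f, 'r) fo_struct \<Rightarrow> bool" where
  "connected_component_exists L m \<kappa> M \<longleftrightarrow>
     (\<forall>A \<subseteq> universe M. small \<kappa> A \<longrightarrow>
        connected_component_over L m M A = connected_component_over L m M {})"

text \<open>Only meaningful when the connected component exists.\<close>

definition connected_component ::
    "('f, 'r) language \<Rightarrow> 'f \<Rightarrow> ('a, 'f, 'r) fo_struct \<Rightarrow> 'a set" where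
  "connected_component L m M = connected_component_over L m M {}"

end

theory Submission
  imports Defs
begin

text \<open>
  Write \<open>G\<^sup>n\<close> for the subgroup generated by the \<open>n\<close>-th powers. Two facts about the finitely generated
  virtually nilpotent group \<open>G\<close> carry the proof: for every \<open>n\<close> some \<open>G\<^sup>K\<close> consists of \<open>n\<close>-th powers, and
  every \<open>G\<^sup>n\<close> has finite index.

  For the first fact let \<open>D\<close> be a central series of a nilpotent group of class \<open>c\<close> and let \<open>A\<close> be a
  subgroup with commutators in \<open>D j\<close>. Modulo the \<open>m\<close>-th powers of \<open>D j\<close>, the elements \<open>a ^ (m ^ c)\<close> are
  central in \<open>A\<close>, so \<open>a \<mapsto> a ^ (m ^ (c + 1))\<close> is a homomorphism. Hence a product of such powers is the
  power of a single \<open>b\<close> times \<open>m\<close>-th powers of \<open>D j\<close>, and one continues in the subgroup generated by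
  \<open>b\<close> and \<open>D j\<close>. For the second fact, \<open>G / G\<^sup>n\<close> is finite because along the series of a nilpotent
  subgroup of finite index each term is finitely generated and has finite index, by Schreier's lemma
  and the finiteness of finitely generated abelian groups of bounded exponent.

  Consequently, for each \<open>n\<close> there are finitely many elements of \<open>G\<close> whose products with \<open>n\<close>-th powers
  exhaust \<open>G\<close>. This and the first fact are expressed by first-order sentences and so pass to \<open>G\<^sup>*\<close>,
  where they show that \<open>G\<^sup>*\<^sup>n\<close> has finite index and that it is a set of products of boundedly many
  \<open>n\<close>-th powers, hence definable without parameters. Every subgroup of finite index contains some
  \<open>G\<^sup>*\<^sup>n\<close>, which identifies the connected component; its divisibility follows from the first fact by
  saturation.
\<close>

section \<open>Commutators and quotients\<close>

abbreviation commutator :: "('a, 'b) monoid_scheme \<Rightarrow> 'a \<Rightarrow> 'a \<Rightarrow> 'a" where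
  "commutator G x y \<equiv> x \<otimes>\<^bsub>G\<^esub> y \<otimes>\<^bsub>G\<^esub> inv\<^bsub>G\<^esub> x \<otimes>\<^bsub>G\<^esub> inv\<^bsub>G\<^esub> y"

lemma (in normal) group_hom_Mod: "group_hom G (G Mod H) (\<lambda>x. H #> x)"
  by (intro group_hom.intro group_hom_axioms.intro is_group factorgroup_is_group r_coset_hom_Mod)

lemma (in group_hom) hom_commutator:
  assumes "x \<in> carrier G" "y \<in> carrier G"
  shows "h (commutator G x y) = commutator H (h x) (h y)"
  using assms by simp

lemma (in group) commutator_eq_one_iff:
  assumes "x \<in> carrier G" "y \<in> carrier G"
  shows "commutator G x y = \<one> \<longleftrightarrow> x \<otimes> y = y \<otimes> x"
proof -
  have "commutator G x y = (x \<otimes> y) \<otimes> inv (y \<otimes> x)"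
    using assms by (simp add: inv_mult_group m_assoc)
  then show ?thesis
    using assms by (metis inv_closed inv_equality inv_inv m_closed r_inv)
qed

lemma (in normal) coset_eq_one_iff:
  assumes "x \<in> carrier G"
  shows "H #> x = \<one>\<^bsub>G Mod H\<^esub> \<longleftrightarrow> x \<in> H"
  using coset_join1[OF _ assms is_subgroup] coset_join2[OF assms is_subgroup] by auto

lemma (in normal) coset_eq_iff:
  assumes "x \<in> carrier G" "y \<in> carrier G"
  shows "H #> x = H #> y \<longleftrightarrow> x \<otimes> inv y \<in> H"
proof -
  interpret \<pi>: group_hom G "G Mod H" "\<lambda>x. H #> x" by (rule group_hom_Mod)
  have "H #> (x \<otimes> inv y) = (H #> x) \<otimes>\<^bsub>G Mod H\<^esub> inv\<^bsub>G Mod H\<^esub> (H #> y)"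
    using assms by (simp add: \<pi>.hom_mult \<pi>.hom_inv del: mult_FactGroup)
  also have "\<dots> = \<one>\<^bsub>G Mod H\<^esub> \<longleftrightarrow> H #> x = H #> y"
    using assms \<pi>.H.inv_solve_right'[OF \<pi>.H.one_closed \<pi>.hom_closed \<pi>.hom_closed, of x y]
      \<pi>.H.l_one[OF \<pi>.hom_closed] by auto
  finally show ?thesis
    using assms by (subst (asm) coset_eq_one_iff) auto
qed

lemma (in normal) commutator_mem_iff:
  assumes "x \<in> carrier G" "y \<in> carrier G"
  shows "commutator G x y \<in> H \<longleftrightarrow>
    (H #> x) \<otimes>\<^bsub>G Mod H\<^esub> (H #> y) = (H #> y) \<otimes>\<^bsub>G Mod H\<^esub> (H #> x)"
proof -
  interpret \<pi>: group_hom G "G Mod H" "\<lambda>x. H #> x" by (rule group_hom_Mod)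
  have "commutator G x y \<in> H \<longleftrightarrow> H #> commutator G x y = \<one>\<^bsub>G Mod H\<^esub>"
    using assms by (subst coset_eq_one_iff) auto
  also have "H #> commutator G x y = commutator (G Mod H) (H #> x) (H #> y)"
    using assms by (rule \<pi>.hom_commutator)
  finally show ?thesis
    using assms \<pi>.H.commutator_eq_one_iff[OF \<pi>.hom_closed \<pi>.hom_closed] by simp
qed

lemma (in normal) pow_mult_mod:
  assumes "x \<in> carrier G" "y \<in> carrier G" "commutator G x y \<in> H"
  shows "H #> (x \<otimes> y) [^] (n::nat) = H #> (x [^] n \<otimes> y [^] n)"
proof -
  interpret \<pi>: group_hom G "G Mod H" "\<lambda>x. H #> x" by (rule group_hom_Mod)
  have "(H #> x) \<otimes>\<^bsub>G Mod H\<^esub> (H #> y) = (H #> y) \<otimes>\<^bsub>G Mod H\<^esub> (H #> x)"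
    using assms commutator_mem_iff by blast
  from \<pi>.H.pow_mult_distrib[OF this, of n] assms show ?thesis
    by (simp add: \<pi>.hom_nat_pow \<pi>.hom_mult \<pi>.hom_closed del: mult_FactGroup)
qed

lemma (in group) conj_nat_pow:
  assumes "x \<in> carrier G" "y \<in> carrier G"
  shows "(y \<otimes> x \<otimes> inv y) [^] (n::nat) = y \<otimes> x [^] n \<otimes> inv y"
proof (induction n)
  case (Suc n)
  have "inv y \<otimes> (y \<otimes> z) = z" if "z \<in> carrier G" for z
    using that assms by (simp flip: m_assoc)
  then show ?case
    using Suc assms by (simp add: m_assoc)
qed (use assms in simp)

lemma (in group) centralizer_subgroup:
  assumes "S \<subseteq> carrier G"
  shows "subgroup {x \<in> carrier G. \<forall>s\<in>S. x \<otimes> s = s \<otimes> x} G"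
proof (rule subgroupI)
  show "inv a \<in> {x \<in> carrier G. \<forall>s\<in>S. x \<otimes> s = s \<otimes> x}"
    if a: "a \<in> {x \<in> carrier G. \<forall>s\<in>S. x \<otimes> s = s \<otimes> x}" for a
  proof -
    have "inv a \<otimes> s = s \<otimes> inv a" if s: "s \<in> S" for s
    proof -
      have as: "a \<in> carrier G" "s \<in> carrier G" "a \<otimes> s = s \<otimes> a" using a s assms by auto
      have "inv a \<otimes> s = inv a \<otimes> (s \<otimes> a) \<otimes> inv a"
        using as(1,2) by (simp add: m_assoc)
      also have "\<dots> = inv a \<otimes> (a \<otimes> s) \<otimes> inv a"
        using as(3) by simp
      also have "\<dots> = s \<otimes> inv a"
        using as(1,2) by (simp flip: m_assoc)
      finally show ?thesis .
    qed
    then show ?thesis using a by simp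
  qed
  show "a \<otimes> b \<in> {x \<in> carrier G. \<forall>s\<in>S. x \<otimes> s = s \<otimes> x}"
    if "a \<in> {x \<in> carrier G. \<forall>s\<in>S. x \<otimes> s = s \<otimes> x}"
      "b \<in> {x \<in> carrier G. \<forall>s\<in>S. x \<otimes> s = s \<otimes> x}" for a b
  proof -
    have "a \<otimes> b \<otimes> s = s \<otimes> (a \<otimes> b)" if "s \<in> S" for s
    proof -
      have as: "a \<in> carrier G" "b \<in> carrier G" "s \<in> carrier G" "a \<otimes> s = s \<otimes> a" "b \<otimes> s = s \<otimes> b"
        using \<open>a \<in> _\<close> \<open>b \<in> _\<close> that assms by auto
      have "a \<otimes> b \<otimes> s = (a \<otimes> s) \<otimes> b"
        using as(1-3,5) by (simp add: m_assoc)
      also have "\<dots> = s \<otimes> (a \<otimes> b)"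
        using as by (simp flip: m_assoc)
      finally show ?thesis .
    qed
    then show ?thesis using that by simp
  qed
qed (use assms in \<open>auto simp: subset_iff\<close>)

text \<open>Double centralizer argument: the centralizer of \<open>S\<close> is a subgroup
  containing \<open>S\<close>, hence contains \<open>generate G S\<close>. So \<open>S\<close> lies
  in the centralizer of \<open>generate G S\<close>, which is again a subgroup.\<close>

lemma (in group) generate_commute:
  assumes "S \<subseteq> carrier G" "\<And>x y. x \<in> S \<Longrightarrow> y \<in> S \<Longrightarrow> x \<otimes> y = y \<otimes> x"
    and "x \<in> generate G S" "y \<in> generate G S"
  shows "x \<otimes> y = y \<otimes> x"
proof -
  have c: "generate G S \<subseteq> carrier G"
    using assms(1) by (rule generate_incl)
  have *: "generate G S \<subseteq> {x \<in> carrier G. \<forall>s\<in>S. x \<otimes> s = s \<otimes> x}"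
    using assms(1,2) by (intro generate_subgroup_incl centralizer_subgroup) auto
  have "generate G S \<subseteq> {x \<in> carrier G. \<forall>s\<in>generate G S. x \<otimes> s = s \<otimes> x}"
  proof (rule generate_subgroup_incl[OF _ centralizer_subgroup[OF c]])
    show "S \<subseteq> {x \<in> carrier G. \<forall>s\<in>generate G S. x \<otimes> s = s \<otimes> x}"
    proof safe
      fix x s assume "x \<in> S" "s \<in> generate G S"
      then have "s \<otimes> x = x \<otimes> s" using * by blast
      then show "x \<otimes> s = s \<otimes> x" by simp
    qed (use assms(1) in auto)
  qed
  then show ?thesis
    using assms(3,4) by blast
qed

text \<open>The images of the generators commute pairwise in \<open>G Mod H\<close>, so
  \<open>generate_commute\<close> applies there.\<close>

lemma (in normal) commutator_generate_mem:
  assumes "S \<subseteq> carrier G" "\<And>x y. x \<in> S \<Longrightarrow> y \<in> S \<Longrightarrow> commutator G x y \<in> H"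
    and "x \<in> generate G S" "y \<in> generate G S"
  shows "commutator G x y \<in> H"
proof -
  interpret \<pi>: group_hom G "G Mod H" "\<lambda>x. H #> x" by (rule group_hom_Mod)
  have S: "(\<lambda>x. H #> x) ` S \<subseteq> carrier (G Mod H)"
    using assms(1) \<pi>.hom_closed by blast
  have xy: "x \<in> carrier G" "y \<in> carrier G"
    using assms generate_in_carrier by auto
  have "(H #> x) \<otimes>\<^bsub>G Mod H\<^esub> (H #> y) = (H #> y) \<otimes>\<^bsub>G Mod H\<^esub> (H #> x)"
  proof (rule \<pi>.H.generate_commute[OF S])
    fix u v assume "u \<in> (\<lambda>x. H #> x) ` S" "v \<in> (\<lambda>x. H #> x) ` S"
    then show "u \<otimes>\<^bsub>G Mod H\<^esub> v = v \<otimes>\<^bsub>G Mod H\<^esub> u"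
      using assms(1,2) commutator_mem_iff by blast
  qed (use assms \<pi>.generate_img in blast)+
  then show ?thesis
    using xy commutator_mem_iff by blast
qed

section \<open>Products of powers in nilpotent groups\<close>

text \<open>The index runs over all naturals so that sums such as \<open>j + k + l\<close> may
  exceed \<open>c\<close>; the terms are trivial there. Where the series starts is left open:
  \<open>products_of_powers\<close> adds that \<open>D 0\<close> is the whole group.\<close>

locale central_series = group +
  fixes D :: "nat \<Rightarrow> 'a set" and c :: nat
  assumes subgroup_D: "subgroup (D i) G"
    and D_c: "D c = {\<one>}"
    and D_Suc: "D (Suc i) \<subseteq> D i"
    and commutator_D: "x \<in> D i \<Longrightarrow> y \<in> carrier G \<Longrightarrow> commutator G x y \<in> D (Suc i)"
begin

lemma D_carrier: "x \<in> D i \<Longrightarrow> x \<in> carrier G"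
  by (rule subgroup.mem_carrier[OF subgroup_D])

lemma normal_D: "D i \<lhd> G"
proof (rule normal_invI[OF subgroup_D])
  fix y x assume y: "y \<in> carrier G" and x: "x \<in> D i"
  have "y \<otimes> x \<otimes> inv y = inv (commutator G x y) \<otimes> x"
    using x y D_carrier by (simp add: inv_mult_group m_assoc)
  then show "y \<otimes> x \<otimes> inv y \<in> D i"
    using subgroup.m_closed[OF subgroup_D subgroup.m_inv_closed[OF subgroup_D
          subsetD[OF D_Suc commutator_D[OF x y]]] x] by simp
qed

lemma D_ge: "i \<ge> c \<Longrightarrow> D i = {\<one>}"
proof (induction i rule: dec_induct)
  case (step i)
  then show ?case
    using D_Suc[of i] subgroup.one_closed[OF subgroup_D[of "Suc i"]] by auto
qed (rule D_c)

lemma commutator_D':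
  assumes "x \<in> carrier G" "y \<in> D i"
  shows "commutator G x y \<in> D (Suc i)"
proof -
  have "commutator G x y = inv (commutator G y x)"
    using assms D_carrier by (simp add: inv_mult_group m_assoc)
  then show ?thesis
    using subgroup.m_inv_closed[OF subgroup_D commutator_D[OF assms(2,1)]] by simp
qed

text \<open>Conjugation by \<open>y\<close> multiplies \<open>z\<close> by an element \<open>w\<close> of the series with \<open>w\<^sup>m = 1\<close> which commutes
  with \<open>z\<close> modulo the next term; so modulo that term it fixes \<open>z\<^sup>m\<close>.\<close>

lemma commutator_pow_mem:
  assumes m: "\<And>d. d \<in> D j \<Longrightarrow> d [^] (m::nat) = \<one>"
    and "z \<in> carrier G" "y \<in> carrier G" "commutator G z y \<in> D (j + k)"
  shows "commutator G (z [^] (m ^ l)) y \<in> D (j + k + l)"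
proof (induction l)
  case 0
  then show ?case using assms by simp
next
  case (Suc l)
  define z' where "z' = z [^] (m ^ l)"
  define w where "w = commutator G z' y"
  define i where "i = j + k + l"
  have z': "z' \<in> carrier G" using assms by (simp add: z'_def)
  have w: "w \<in> D i" using Suc by (simp add: w_def z'_def i_def)
  \<comment> \<open>The exponent bound concerns \<open>D j\<close> only; \<open>w\<close> lies in a
    later term of the series.\<close>
  have wj: "w \<in> D j"
    using w lift_Suc_antimono_le[of D j i] D_Suc by (auto simp: i_def)
  have wG: "w \<in> carrier G" using w D_carrier by blast
  interpret N: normal "D (Suc i)" G by (rule normal_D)
  interpret \<pi>: group_hom G "G Mod D (Suc i)" "\<lambda>x. D (Suc i) #> x" by (rule N.group_hom_Mod)
  have conj: "y \<otimes> z' \<otimes> inv y = inv w \<otimes> z'"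
    using z' \<open>y \<in> carrier G\<close> by (simp add: w_def inv_mult_group m_assoc)
  have pow: "y \<otimes> z' [^] m \<otimes> inv y = (inv w \<otimes> z') [^] m"
    unfolding conj[symmetric] using z' \<open>y \<in> carrier G\<close> by (simp add: conj_nat_pow)
  have "inv w \<in> D i"
    by (rule subgroup.m_inv_closed[OF subgroup_D w])
  then have "D (Suc i) #> (inv w \<otimes> z') [^] m = D (Suc i) #> (inv w [^] m \<otimes> z' [^] m)"
    using z' wG commutator_D[of "inv w" i z'] by (intro N.pow_mult_mod) auto
  also have "inv w [^] m = \<one>"
    using m[OF wj] wG by (metis inv_one nat_pow_inv)
  finally have "D (Suc i) #> (y \<otimes> z' [^] m \<otimes> inv y) = D (Suc i) #> z' [^] m"
    using z' by (simp add: pow)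
  then have "y \<otimes> z' [^] m \<otimes> inv y \<otimes> inv (z' [^] m) \<in> D (Suc i)"
    using z' assms by (subst (asm) N.coset_eq_iff) auto
  moreover have "inv (commutator G y (z' [^] m)) = commutator G (z' [^] m) y"
    using z' assms by (simp add: inv_mult_group m_assoc)
  ultimately have "commutator G (z' [^] m) y \<in> D (Suc i)"
    by (metis N.m_inv_closed)
  then show ?case
    using assms by (simp add: z'_def nat_pow_pow i_def mult.commute)
qed

text \<open>By the previous lemma the powers \<open>a\<close>, \<open>b\<close>, \<open>s\<close> of \<open>x\<close>, \<open>y\<close>, \<open>x y\<close> with exponent \<open>m ^ c\<close> commute
  with \<open>A\<close>; the defect \<open>a b s\<^sup>-\<^sup>1\<close> lies in \<open>D j\<close>, so one more power \<open>m\<close> kills it.\<close>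

lemma pow_hom_of_bounded_exponent:
  assumes m: "\<And>d. d \<in> D j \<Longrightarrow> d [^] (m::nat) = \<one>"
    and A: "subgroup A G" "\<And>x y. x \<in> A \<Longrightarrow> y \<in> A \<Longrightarrow> commutator G x y \<in> D j"
    and xy: "x \<in> A" "y \<in> A"
  shows "(x \<otimes> y) [^] (m ^ Suc c) = x [^] (m ^ Suc c) \<otimes> y [^] (m ^ Suc c)"
proof -
  define q where "q = m ^ c"
  have AG: "z \<in> carrier G" if "z \<in> A" for z using that A(1) subgroup.mem_carrier by metis
  have central: "z [^] q \<otimes> y = y \<otimes> z [^] q" if "z \<in> A" "y \<in> A" for z y
  proof -
    \<comment> \<open>Commutators of \<open>A\<close> start in \<open>D j\<close>, whence the
      \<open>0\<close>. Each factor \<open>m\<close> of \<open>q\<close> moves them one term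
      further, and \<open>j + c\<close> is past the end of the series.\<close>
    have "commutator G (z [^] q) y \<in> D (j + 0 + c)"
      unfolding q_def using that AG A(2) by (intro commutator_pow_mem[OF m]) auto
    then show ?thesis
      using D_ge[of "j + 0 + c"] that AG commutator_eq_one_iff by auto
  qed
  have powA: "z [^] (k::nat) \<in> A" if "z \<in> A" for z k
    using that A(1) by (induction k) (auto simp: subgroup.one_closed subgroup.m_closed)
  define a b s where "a = x [^] q" and "b = y [^] q" and "s = (x \<otimes> y) [^] q"
  have xyA: "x \<otimes> y \<in> A" using xy A(1) subgroup.m_closed by metis
  have abs: "a \<in> A" "b \<in> A" "s \<in> A" "inv s \<in> A"
    using xy xyA powA A(1) by (auto simp: a_def b_def s_def subgroup.m_inv_closed)
  interpret N: normal "D j" G by (rule normal_D)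
  have "D j #> (a \<otimes> b) = D j #> s"
    unfolding a_def b_def s_def using xy AG A(2) by (subst N.pow_mult_mod) auto
  then have t: "a \<otimes> b \<otimes> inv s \<in> D j"
    using abs AG by (subst (asm) N.coset_eq_iff) auto
  have com: "a \<otimes> b = b \<otimes> a" "(a \<otimes> b) \<otimes> s = s \<otimes> (a \<otimes> b)"
    using central[OF xy(1) abs(2)] central[OF xyA, of "a \<otimes> b"] abs A(1)
    by (auto simp: a_def s_def subgroup.m_closed)
  have ab: "(a \<otimes> b) \<in> carrier G" "s \<in> carrier G" using abs AG by auto
  \<comment> \<open>The defect commutes with \<open>s\<close>, so the power \<open>m\<close>
    distributes over this factorization.\<close>
  have "a \<otimes> b = (a \<otimes> b \<otimes> inv s) \<otimes> s"
    using ab by (simp add: m_assoc)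
  moreover have "(a \<otimes> b \<otimes> inv s) \<otimes> s = s \<otimes> (a \<otimes> b \<otimes> inv s)"
    using ab com(2) by (metis inv_closed inv_solve_right' m_assoc m_closed)
  ultimately have "(a \<otimes> b) [^] m = (a \<otimes> b \<otimes> inv s) [^] m \<otimes> s [^] m"
    using ab abs AG pow_mult_distrib by (metis inv_closed m_closed)
  also have "\<dots> = s [^] m"
    using m[OF t] ab by simp
  finally have "a [^] m \<otimes> b [^] m = s [^] m"
    using com(1) abs AG pow_mult_distrib by metis
  then show ?thesis
    using xy xyA AG by (simp add: a_def b_def s_def q_def nat_pow_pow mult.commute)
qed

text \<open>Serves to factor out the \<open>m\<close>-th powers of a term of the series: in that
  quotient the term acquires the exponent bound that \<open>pow_hom_of_bounded_exponent\<close>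
  requires.\<close>

lemma series_Mod:
  assumes "N \<lhd> G"
  shows "central_series (G Mod N) (\<lambda>i. (\<lambda>x. N #> x) ` D i) c"
proof -
  interpret N: normal N G by fact
  interpret \<pi>: group_hom G "G Mod N" "\<lambda>x. N #> x" by (rule N.group_hom_Mod)
  show ?thesis
  proof (intro central_series.intro central_series_axioms.intro \<pi>.H.is_group)
    show "subgroup ((\<lambda>x. N #> x) ` D i) (G Mod N)" for i
      by (rule \<pi>.subgroup_img_is_subgroup[OF subgroup_D])
    show "(\<lambda>x. N #> x) ` D c = {\<one>\<^bsub>G Mod N\<^esub>}"
      using \<pi>.hom_one by (simp add: D_c)
    show "(\<lambda>x. N #> x) ` D (Suc i) \<subseteq> (\<lambda>x. N #> x) ` D i" for i
      using D_Suc by (intro image_mono)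
    show "commutator (G Mod N) X Y \<in> (\<lambda>x. N #> x) ` D (Suc i)"
      if XY: "X \<in> (\<lambda>x. N #> x) ` D i" "Y \<in> carrier (G Mod N)" for X Y i
    proof -
      obtain x where x: "x \<in> D i" "X = N #> x" using XY(1) by auto
      obtain y where y: "y \<in> carrier G" "Y = N #> y" using XY(2) by (auto simp: carrier_FactGroup)
      have "commutator (G Mod N) X Y = N #> commutator G x y"
        unfolding x y by (rule \<pi>.hom_commutator[OF D_carrier[OF x(1)] y(1), symmetric])
      then show ?thesis
        using commutator_D[OF x(1) y(1)] by blast
    qed
  qed
qed

text \<open>The induction passes from \<open>A\<close> to the subgroup generated by a single element \<open>b\<close> and \<open>D j\<close>, whose
  commutators lie one step further down the series.\<close>

lemma products_of_powers_aux:
  assumes "i \<le> c" "n \<ge> 1"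
  shows "\<exists>M\<ge>(1::nat). \<forall>A. subgroup A G \<longrightarrow> (\<forall>x\<in>A. \<forall>y\<in>A. commutator G x y \<in> D (c - i)) \<longrightarrow>
    generate G {a [^] M | a. a \<in> A} \<subseteq> {a [^] (n::nat) | a. a \<in> carrier G}"
  using assms
proof (induction i arbitrary: n)
  case 0
  \<comment> \<open>Here \<open>A\<close> is abelian because \<open>D c\<close> is trivial, so its
    \<open>n\<close>-th powers already form a subgroup and \<open>M = n\<close> works.\<close>
  have "generate G {a [^] n | a. a \<in> A} \<subseteq> {a [^] n | a. a \<in> carrier G}"
    if A: "subgroup A G" and com: "\<forall>x\<in>A. \<forall>y\<in>A. commutator G x y \<in> D c" for A
  proof
    have AG: "a \<in> carrier G" if "a \<in> A" for a using that A subgroup.mem_carrier by metis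
    have com': "x \<otimes> y = y \<otimes> x" if "x \<in> A" "y \<in> A" for x y
      using com that commutator_eq_one_iff[OF AG AG, OF that] by (simp add: D_c)
    fix u assume "u \<in> generate G {a [^] n | a. a \<in> A}"
    then have "\<exists>a\<in>A. u = a [^] n"
    proof (induction rule: generate.induct)
      case one
      show ?case using A subgroup.one_closed by (metis nat_pow_one)
    next
      case (incl h) then show ?case by auto
    next
      case (inv h)
      then obtain a where a: "a \<in> A" "h = a [^] n" by auto
      then show ?case
        using subgroup.m_inv_closed[OF A a(1)] nat_pow_inv[OF AG[OF a(1)], of n] by (intro bexI[of _ "inv a"]) auto
    next
      case (eng h1 h2)
      then obtain a b where ab: "a \<in> A" "h1 = a [^] n" "b \<in> A" "h2 = b [^] n" by auto
      then show ?case
        using pow_mult_distrib[OF com'[OF ab(1,3)] AG AG, OF ab(1,3), of n]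
          subgroup.m_closed[OF A ab(1,3)] by (intro bexI[of _ "a \<otimes> b"]) auto
    qed
    then show "u \<in> {a [^] n | a. a \<in> carrier G}" using AG by auto
  qed
  then show ?case using 0 by auto
next
  case (Suc i)
  define j where "j = c - Suc i"
  have j: "c - i = Suc j" using Suc.prems by (auto simp: j_def)
  obtain m :: nat where m: "m \<ge> 1" and IH: "\<And>A. subgroup A G \<Longrightarrow>
      (\<And>x y. x \<in> A \<Longrightarrow> y \<in> A \<Longrightarrow> commutator G x y \<in> D (Suc j)) \<Longrightarrow>
      generate G {a [^] m | a. a \<in> A} \<subseteq> {a [^] n | a. a \<in> carrier G}"
    using Suc.IH[of n] Suc.prems unfolding j by (meson Suc_leD)
  \<comment> \<open>Modulo \<open>N\<close> the \<open>m\<close>-th powers of \<open>D j\<close>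
    vanish, while elements of \<open>N\<close> remain products of \<open>m\<close>-th powers, to
    which \<open>IH\<close> will apply.\<close>
  define N where "N = generate G {d [^] m | d. d \<in> D j}"
  have powD: "{d [^] m | d. d \<in> D j} \<subseteq> carrier G" using D_carrier by auto
  interpret N: normal N G
    unfolding N_def
  proof (rule normal_generateI[OF powD])
    fix h g assume h: "h \<in> {d [^] m | d. d \<in> D j}" and g: "g \<in> carrier G"
    then obtain d where d: "d \<in> D j" "h = d [^] m" by auto
    have "g \<otimes> h \<otimes> inv g = (g \<otimes> d \<otimes> inv g) [^] m"
      using d g D_carrier by (simp add: conj_nat_pow)
    then show "g \<otimes> h \<otimes> inv g \<in> {d [^] m | d. d \<in> D j}"
      using normal.inv_op_closed2[OF normal_D g d(1)] by auto
  qed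
  interpret \<pi>: group_hom G "G Mod N" "\<lambda>x. N #> x" by (rule N.group_hom_Mod)
  interpret K: central_series "G Mod N" "\<lambda>i. (\<lambda>x. N #> x) ` D i" c
    by (rule series_Mod[OF N.normal_axioms])
  define M where "M = m ^ Suc c"
  have "generate G {a [^] M | a. a \<in> A} \<subseteq> {a [^] n | a. a \<in> carrier G}"
    if A: "subgroup A G" and com: "\<forall>x\<in>A. \<forall>y\<in>A. commutator G x y \<in> D j" for A
  proof
    have AG: "a \<in> carrier G" if "a \<in> A" for a using that A subgroup.mem_carrier by metis
    have hom: "N #> (x \<otimes> y) [^] M = N #> (x [^] M \<otimes> y [^] M)" if xy: "x \<in> A" "y \<in> A" for x y
    proof -
      have "((N #> x) \<otimes>\<^bsub>G Mod N\<^esub> (N #> y)) [^]\<^bsub>G Mod N\<^esub> M =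
          (N #> x) [^]\<^bsub>G Mod N\<^esub> M \<otimes>\<^bsub>G Mod N\<^esub> (N #> y) [^]\<^bsub>G Mod N\<^esub> M"
        unfolding M_def
      proof (rule K.pow_hom_of_bounded_exponent[where A = "(\<lambda>x. N #> x) ` A" and j = j])
        show "X [^]\<^bsub>G Mod N\<^esub> m = \<one>\<^bsub>G Mod N\<^esub>" if X: "X \<in> (\<lambda>x. N #> x) ` D j" for X
        proof -
          obtain d where d: "d \<in> D j" "X = N #> d" using X by auto
          have "d [^] m \<in> N" unfolding N_def using d by (auto intro: generate.incl)
          then have "N #> d [^] m = \<one>\<^bsub>G Mod N\<^esub>"
            using D_carrier[OF d(1)] by (subst N.coset_eq_one_iff) auto
          then show ?thesis
            using d D_carrier[OF d(1)] by (simp add: \<pi>.hom_nat_pow)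
        qed
        show "subgroup ((\<lambda>x. N #> x) ` A) (G Mod N)"
          by (rule \<pi>.subgroup_img_is_subgroup[OF A])
        show "commutator (G Mod N) X Y \<in> (\<lambda>x. N #> x) ` D j"
          if XY: "X \<in> (\<lambda>x. N #> x) ` A" "Y \<in> (\<lambda>x. N #> x) ` A" for X Y
        proof -
          obtain x y where xy: "x \<in> A" "y \<in> A" "X = N #> x" "Y = N #> y" using XY by auto
          have "commutator (G Mod N) X Y = N #> commutator G x y"
            unfolding xy by (rule \<pi>.hom_commutator[OF AG[OF xy(1)] AG[OF xy(2)], symmetric])
          then show ?thesis
            using com xy by blast
        qed
      qed (use xy in auto)
      then show ?thesis
        using AG[OF xy(1)] AG[OF xy(2)]
        by (simp add: \<pi>.hom_nat_pow \<pi>.hom_mult \<pi>.hom_closed del: mult_FactGroup)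
    qed
    fix u assume u: "u \<in> generate G {a [^] M | a. a \<in> A}"
    have uG: "u \<in> carrier G"
      using generate_in_carrier[OF _ u] AG by auto
    \<comment> \<open>Modulo \<open>N\<close> raising to the power \<open>M\<close> is a
      homomorphism on \<open>A\<close>, so its values are closed under products and
      inverses.\<close>
    from u have "\<exists>b\<in>A. N #> u = N #> b [^] M"
    proof (induction rule: generate.induct)
      case one
      show ?case using subgroup.one_closed[OF A] by (intro bexI[of _ \<one>]) auto
    next
      case (incl h) then show ?case by auto
    next
      case (inv h)
      then obtain a where a: "a \<in> A" "h = a [^] M" by auto
      then show ?case
        using subgroup.m_inv_closed[OF A a(1)] nat_pow_inv[OF AG[OF a(1)], of M]
        by (intro bexI[of _ "inv a"]) auto
    next
      case (eng h1 h2)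
      then obtain a b where ab: "a \<in> A" "N #> h1 = N #> a [^] M" "b \<in> A" "N #> h2 = N #> b [^] M"
        by auto
      have hG: "h1 \<in> carrier G" "h2 \<in> carrier G"
        using generate_in_carrier[OF _ eng(1)] generate_in_carrier[OF _ eng(2)] AG by auto
      have "N #> (h1 \<otimes> h2) = (N #> h1) \<otimes>\<^bsub>G Mod N\<^esub> (N #> h2)"
        using hG by (rule \<pi>.hom_mult)
      also have "\<dots> = N #> (a [^] M \<otimes> b [^] M)"
        unfolding ab(2,4) using ab(1,3) AG by (intro \<pi>.hom_mult[symmetric]) auto
      also have "\<dots> = N #> (a \<otimes> b) [^] M"
        using hom ab by auto
      finally show ?case
        using subgroup.m_closed[OF A ab(1,3)] by blast
    qed
    then obtain b where b: "b \<in> A" "N #> u = N #> b [^] M" by auto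
    have bG: "b \<in> carrier G" using AG b by auto
    define B where "B = generate G (insert b (D j))"
    have gens: "insert b (D j) \<subseteq> carrier G" using bG D_carrier by auto
    have BG: "subgroup B G" unfolding B_def using gens by (rule generate_is_subgroup)
    have "generate G {a [^] m | a. a \<in> B} \<subseteq> {a [^] n | a. a \<in> carrier G}"
    proof (rule IH[OF BG])
      \<comment> \<open>It suffices to look at generators: \<open>b\<close> commutes with itself,
        and a commutator with an entry in \<open>D j\<close> falls into the next term.\<close>
      show "commutator G x y \<in> D (Suc j)" if "x \<in> B" "y \<in> B" for x y
      proof (rule normal.commutator_generate_mem[OF normal_D gens])
        have "commutator G b b = \<one>"
          using bG by (subst commutator_eq_one_iff) auto
        then show "commutator G x y \<in> D (Suc j)" if "x \<in> insert b (D j)" "y \<in> insert b (D j)" for x y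
          using that bG D_carrier commutator_D commutator_D' subgroup.one_closed[OF subgroup_D] by auto
      qed (use that in \<open>auto simp: B_def\<close>)
    qed
    \<comment> \<open>\<open>u\<close> is an element of \<open>N\<close> times
      \<open>b [^] M\<close>. Both are products of \<open>m\<close>-th powers from \<open>B\<close>,
      the latter because \<open>m\<close> divides \<open>M\<close>.\<close>
    moreover have "u \<in> generate G {a [^] m | a. a \<in> B}"
    proof -
      have "u \<otimes> inv (b [^] M) \<in> N"
        using b(2) uG bG by (subst (asm) N.coset_eq_iff) auto
      moreover have "N \<subseteq> generate G {a [^] m | a. a \<in> B}"
        unfolding N_def by (rule mono_generate) (auto simp: B_def intro: generate.incl)
      moreover have "b [^] M \<in> generate G {a [^] m | a. a \<in> B}"
      proof (rule generate.incl)
        have "b \<in> B" by (auto simp: B_def intro: generate.incl)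
        then have "b [^] (k::nat) \<in> B" for k
          by (induction k) (auto intro: subgroup.one_closed[OF BG] subgroup.m_closed[OF BG])
        moreover have "b [^] M = (b [^] (m ^ c)) [^] m"
          using bG by (simp add: M_def nat_pow_pow mult.commute)
        ultimately show "b [^] M \<in> {a [^] m | a. a \<in> B}" by blast
      qed
      ultimately have "u \<otimes> inv (b [^] M) \<otimes> b [^] M \<in> generate G {a [^] m | a. a \<in> B}"
        by (auto intro: generate.eng)
      then show ?thesis using uG bG by (simp add: m_assoc)
    qed
    ultimately show "u \<in> {a [^] n | a. a \<in> carrier G}" by blast
  qed
  moreover have "M \<ge> 1" using m by (simp add: M_def)
  ultimately show ?case unfolding j_def by blast
qed

lemma products_of_powers:
  assumes "D 0 = carrier G" "n \<ge> 1"
  shows "\<exists>M\<ge>(1::nat). power_subgroup G M \<subseteq> {a [^] (n::nat) | a. a \<in> carrier G}"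
proof -
  \<comment> \<open>For \<open>i = c\<close> the commutators are only asked to lie in
    \<open>D 0\<close>, the whole group.\<close>
  obtain M :: nat where "M \<ge> 1" and M: "\<And>A. subgroup A G \<Longrightarrow> \<forall>x\<in>A. \<forall>y\<in>A. commutator G x y \<in> D (c - c) \<Longrightarrow>
      generate G {a [^] M | a. a \<in> A} \<subseteq> {a [^] n | a. a \<in> carrier G}"
    using products_of_powers_aux[of c n] assms by blast
  have "power_subgroup G M \<subseteq> {a [^] n | a. a \<in> carrier G}"
    unfolding power_subgroup_def by (rule M[OF subgroup_self]) (simp add: assms)
  then show ?thesis
    using \<open>M \<ge> 1\<close> by blast
qed

end

section \<open>The lower central series\<close>

lemma (in group) lower_central_subgroup: "subgroup (lower_central G i) G"
proof (induction i)
  case 0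
  show ?case by (simp add: subgroup_self)
next
  case (Suc i)
  then show ?case
    by (auto intro!: generate_is_subgroup dest: subgroup.mem_carrier)
qed

lemma (in group) lower_central_decreasing: "lower_central G (Suc i) \<subseteq> lower_central G i"
proof (induction i)
  case 0
  show ?case
    using subgroup.subset[OF lower_central_subgroup[of "Suc 0"]] by simp
next
  case (Suc i)
  show ?case
    unfolding lower_central.simps(2)[of G "Suc i"]
    by (subst lower_central.simps(2), rule mono_generate) (use Suc in blast)
qed

lemma nilpotent_group_products_of_powers:
  assumes "nilpotent_group G" "n \<ge> 1"
  shows "\<exists>M\<ge>(1::nat). power_subgroup G M \<subseteq> {a [^]\<^bsub>G\<^esub> (n::nat) | a. a \<in> carrier G}"
proof -
  interpret group G using assms by (simp add: nilpotent_group_def)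
  obtain c where "lower_central G c = {\<one>\<^bsub>G\<^esub>}" using assms by (auto simp: nilpotent_group_def)
  then interpret central_series G "lower_central G" c
    by (intro central_series.intro central_series_axioms.intro is_group lower_central_subgroup
        lower_central_decreasing) (auto intro!: generate.incl)
  show ?thesis by (rule products_of_powers) (use assms in auto)
qed

section \<open>Subgroups of finite index\<close>

text \<open>\<open>F\<close> may meet a coset more than once. Such covers pass directly to quotients
  and can be multiplied along a chain of subgroups.\<close>

lemma (in group) finite_index_iff:
  assumes "subgroup H G"
  shows "finite (rcosets H) \<longleftrightarrow>
    (\<exists>F. finite F \<and> F \<subseteq> carrier G \<and> (\<forall>x\<in>carrier G. \<exists>h\<in>H. \<exists>f\<in>F. x = h \<otimes> f))"
proof
  assume fin: "finite (rcosets H)"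
  have "rcosets H = (\<lambda>x. H #> x) ` carrier G"
    by (auto simp: RCOSETS_def)
  then obtain F where F: "F \<subseteq> carrier G" "finite F" "rcosets H = (\<lambda>x. H #> x) ` F"
    using finite_subset_image[OF fin, of "\<lambda>x. H #> x" "carrier G"] by auto
  have "\<exists>h\<in>H. \<exists>f\<in>F. x = h \<otimes> f" if x: "x \<in> carrier G" for x
  proof -
    have "H #> x \<in> rcosets H" using x by (auto simp: RCOSETS_def)
    then obtain f where f: "f \<in> F" "H #> x = H #> f" using F by auto
    have "x \<in> H #> f" using rcos_self[OF x assms] unfolding f(2) .
    then show ?thesis using f(1) by (auto simp: r_coset_def)
  qed
  then show "\<exists>F. finite F \<and> F \<subseteq> carrier G \<and> (\<forall>x\<in>carrier G. \<exists>h\<in>H. \<exists>f\<in>F. x = h \<otimes> f)"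
    using F by blast
next
  assume "\<exists>F. finite F \<and> F \<subseteq> carrier G \<and> (\<forall>x\<in>carrier G. \<exists>h\<in>H. \<exists>f\<in>F. x = h \<otimes> f)"
  then obtain F where F: "finite F" "F \<subseteq> carrier G" "\<forall>x\<in>carrier G. \<exists>h\<in>H. \<exists>f\<in>F. x = h \<otimes> f"
    by blast
  have "rcosets H \<subseteq> (\<lambda>x. H #> x) ` F"
  proof
    fix X assume "X \<in> rcosets H"
    then obtain x where x: "x \<in> carrier G" "X = H #> x" by (auto simp: RCOSETS_def)
    then obtain h f where hf: "h \<in> H" "f \<in> F" "x = h \<otimes> f" using F by blast
    then have "x \<in> H #> f" by (auto simp: r_coset_def)
    then have "H #> f = H #> x" using repr_independence assms F hf by blast
    then show "X \<in> (\<lambda>x. H #> x) ` F" using x hf by auto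
  qed
  then show "finite (rcosets H)" using finite_subset finite_imageI[OF F(1)] by metis
qed

text \<open>Pigeonhole: two of the powers of \<open>g\<close> with exponents up to \<open>r\<close>
  share a coset of \<open>H\<close>, so \<open>H\<close> contains \<open>g [^] (j - i)\<close> with
  \<open>0 < j - i \<le> r\<close>. The factorial is a multiple of this exponent for every
  \<open>g\<close>; since \<open>H\<close> may fail to be normal, the index itself need not
  work.\<close>

lemma (in group) finite_index_pow_mem:
  assumes "finite_index_subgroup G H"
  shows "\<exists>d\<ge>1. \<forall>g\<in>carrier G. g [^] (d::nat) \<in> H"
proof -
  have H: "subgroup H G" and fin: "finite (rcosets H)"
    using assms by (auto simp: finite_index_subgroup_def)
  have powH: "h [^] (k::nat) \<in> H" if "h \<in> H" for h k
    using that by (induction k) (auto intro: subgroup.one_closed[OF H] subgroup.m_closed[OF H])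
  define r where "r = card (rcosets H)"
  have "g [^] (fact r :: nat) \<in> H" if g: "g \<in> carrier G" for g
  proof -
    have "(\<lambda>i. H #> g [^] i) ` {..r} \<subseteq> rcosets H"
      using g by (auto simp: RCOSETS_def)
    then have "card ((\<lambda>i. H #> g [^] i) ` {..r}) \<le> card (rcosets H)"
      by (rule card_mono[OF fin])
    then have "card ((\<lambda>i. H #> g [^] i) ` {..r}) < card {..r}"
      by (simp add: r_def)
    then have "\<not> inj_on (\<lambda>i. H #> g [^] i) {..r}"
      using pigeonhole by blast
    then obtain i j where ij: "i < j" "j \<le> r" "H #> g [^] i = H #> g [^] j"
      unfolding inj_on_def by (metis atMost_iff nat_neq_iff)
    have "g [^] j \<in> H #> g [^] i"
      unfolding ij(3) using rcos_self[OF _ H] g by simp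
    then obtain h where h: "h \<in> H" "g [^] j = h \<otimes> g [^] i" by (auto simp: r_coset_def)
    have "g [^] (j - i) \<otimes> g [^] i = g [^] j"
      using g ij(1) by (simp add: nat_pow_mult)
    then have "h = g [^] (j - i)"
      using h g subgroup.mem_carrier[OF H h(1)] right_cancel[of "g [^] i" h "g [^] (j - i)"] by simp
    then have "g [^] (j - i) \<in> H" using h by simp
    moreover have "(j - i) dvd fact r"
      using ij by (intro dvd_fact) auto
    ultimately show ?thesis
      using powH g by (metis dvdE nat_pow_pow)
  qed
  moreover have "fact r \<ge> (1::nat)" by simp
  ultimately show ?thesis by blast
qed

text \<open>Schreier's lemma. With \<open>F\<close> a set of representatives and \<open>T\<close> the generators and their inverses,
  \<open>Z\<close> consists of the Schreier generators \<open>t s f\<^sup>-\<^sup>1\<close>; representatives lying in \<open>H\<close> are added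
  because \<open>F\<close> need not be a transversal.\<close>

lemma (in group) finitely_generated_finite_index:
  assumes S: "finite S" "S \<subseteq> carrier G" "generate G S = carrier G"
    and H: "finite_index_subgroup G H"
  shows "\<exists>Y. finite Y \<and> Y \<subseteq> H \<and> generate G Y = H"
proof -
  have sub: "subgroup H G" using H by (simp add: finite_index_subgroup_def)
  have HG: "h \<in> carrier G" if "h \<in> H" for h using that by (rule subgroup.mem_carrier[OF sub])
  \<comment> \<open>The unit is adjoined as the representative with which the rewriting of a word
    starts.\<close>
  obtain F where F: "finite F" "F \<subseteq> carrier G" "\<one> \<in> F"
    "\<And>x. x \<in> carrier G \<Longrightarrow> \<exists>h\<in>H. \<exists>f\<in>F. x = h \<otimes> f"
  proof -
    obtain F where "finite F" "F \<subseteq> carrier G" "\<forall>x\<in>carrier G. \<exists>h\<in>H. \<exists>f\<in>F. x = h \<otimes> f"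
      using H finite_index_iff[OF sub] by (auto simp: finite_index_subgroup_def)
    then show thesis by (intro that[of "insert \<one> F"]) (auto, blast)
  qed
  have FG: "f \<in> carrier G" if "f \<in> F" for f using that F by auto
  define T where "T = S \<union> (\<lambda>s. inv s) ` S"
  define Z where "Z = {h \<in> H. \<exists>t\<in>F. \<exists>s\<in>T. \<exists>f\<in>F. t \<otimes> s = h \<otimes> f}"
  define Y where "Y = Z \<union> (H \<inter> F)"
  have T: "finite T" "T \<subseteq> carrier G" using S by (auto simp: T_def)
  have "Z \<subseteq> (\<lambda>(t, s, f). t \<otimes> s \<otimes> inv f) ` (F \<times> T \<times> F)"
  proof
    fix h assume "h \<in> Z"
    then obtain t s f where *: "h \<in> H" "t \<in> F" "s \<in> T" "f \<in> F" "t \<otimes> s = h \<otimes> f"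
      by (auto simp: Z_def)
    then have "h = t \<otimes> s \<otimes> inv f" using FG HG by (simp add: m_assoc)
    then show "h \<in> (\<lambda>(t, s, f). t \<otimes> s \<otimes> inv f) ` (F \<times> T \<times> F)" using * by force
  qed
  then have "finite Z" using F T by (meson finite_SigmaI finite_imageI finite_subset)
  then have finY: "finite Y" using F by (simp add: Y_def)
  have YH: "Y \<subseteq> H" by (auto simp: Y_def Z_def)
  have YG: "Y \<subseteq> carrier G" using YH HG by auto
  have gen: "\<exists>y\<in>generate G Y. \<exists>f\<in>F. t \<otimes> s = y \<otimes> f" if st: "s \<in> T" "t \<in> F" for s t
  proof -
    obtain h f where "h \<in> H" "f \<in> F" "t \<otimes> s = h \<otimes> f"
      using F(4)[of "t \<otimes> s"] m_closed[OF FG[OF st(2)] subsetD[OF T(2) st(1)]] by blast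
    then have "h \<in> Y" using st by (auto simp: Y_def Z_def)
    then show ?thesis using \<open>f \<in> F\<close> \<open>t \<otimes> s = h \<otimes> f\<close> by (auto intro: generate.incl)
  qed
  \<comment> \<open>A representative is pushed through the word from left to right and leaves a
    product of Schreier generators behind.\<close>
  have all: "\<exists>y\<in>generate G Y. \<exists>f\<in>F. t \<otimes> x = y \<otimes> f" if "x \<in> generate G S" "t \<in> F" for x t
    using that
  proof (induction arbitrary: t rule: generate.induct)
    case one
    then show ?case using FG by (intro bexI[of _ \<one>] bexI[of _ t]) (auto intro: generate.one)
  next
    case (incl h)
    then show ?case by (intro gen) (auto simp: T_def)
  next
    case (inv h)
    then show ?case by (intro gen) (auto simp: T_def)
  next
    case (eng h1 h2)
    obtain y1 f1 where 1: "y1 \<in> generate G Y" "f1 \<in> F" "t \<otimes> h1 = y1 \<otimes> f1"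
      using eng by blast
    obtain y2 f2 where 2: "y2 \<in> generate G Y" "f2 \<in> F" "f1 \<otimes> h2 = y2 \<otimes> f2"
      using eng 1 by blast
    have G: "h1 \<in> carrier G" "h2 \<in> carrier G" "y1 \<in> carrier G" "y2 \<in> carrier G"
      using eng 1 2 generate_in_carrier[OF S(2)] generate_in_carrier[OF YG] by auto
    have "t \<otimes> (h1 \<otimes> h2) = (t \<otimes> h1) \<otimes> h2"
      using G FG eng by (simp add: m_assoc)
    also have "\<dots> = y1 \<otimes> (f1 \<otimes> h2)"
      using G FG 1 by (simp add: m_assoc)
    also have "\<dots> = (y1 \<otimes> y2) \<otimes> f2"
      using G FG 2 by (simp add: m_assoc)
    finally show ?case using 1 2 by (blast intro: generate.eng)
  qed
  have "H \<subseteq> generate G Y"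
  proof
    fix h assume h: "h \<in> H"
    \<comment> \<open>The representative left over at the end lies in \<open>H\<close> together with
      \<open>h\<close> and \<open>y\<close>, hence in \<open>Y\<close>.\<close>
    obtain y f where yf: "y \<in> generate G Y" "f \<in> F" "\<one> \<otimes> h = y \<otimes> f"
      using all[of h \<one>] F(3) HG[OF h] S(3) by auto
    have yH: "y \<in> H" using yf(1) generate_subgroup_incl[OF YH sub] by auto
    have "f = inv y \<otimes> h"
      using yf HG yH h FG by (simp add: inv_solve_left)
    then have "f \<in> H" using yH h sub by (simp add: subgroup.m_closed subgroup.m_inv_closed)
    then have "f \<in> generate G Y" using yf by (auto simp: Y_def intro: generate.incl)
    then show "h \<in> generate G Y" using yf HG h by (auto intro: generate.eng)
  qed
  then show ?thesis using finY YH generate_subgroup_incl[OF YH sub] by blast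
qed

text \<open>Modulo \<open>D\<close> the group \<open>H\<close> is abelian of bounded exponent, so a
  further generator \<open>s\<close> contributes only finitely many powers. Working with
  representatives avoids forming the quotient of \<open>H\<close> by \<open>D\<close>.\<close>

lemma (in group) generate_insert_mod_cosets:
  assumes D: "subgroup D G"
    and n: "n \<ge> 1" "\<And>x. x \<in> carrier G \<Longrightarrow> x [^] (n::nat) = \<one>"
    and H: "subgroup H G" "D \<subseteq> H" "\<And>x y. x \<in> H \<Longrightarrow> y \<in> H \<Longrightarrow> commutator G x y \<in> D"
    and Y: "finite Y" "Y \<subseteq> H"
  shows "\<exists>F. finite F \<and> F \<subseteq> H \<and> (\<forall>x\<in>generate G (Y \<union> D). \<exists>d\<in>D. \<exists>f\<in>F. x = d \<otimes> f)"
  using Y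
proof (induction Y rule: finite_induct)
  case empty
  have "\<forall>x\<in>generate G D. \<exists>d\<in>D. \<exists>f\<in>{\<one>}. x = d \<otimes> f"
    using generate_subgroup_incl[OF subset_refl D] subgroup.mem_carrier[OF D] by fastforce
  then show ?case using subgroup.one_closed[OF H(1)] by (intro exI[of _ "{\<one>}"]) auto
next
  case (insert s Y)
  have HG: "h \<in> carrier G" if "h \<in> H" for h using that by (rule subgroup.mem_carrier[OF H(1)])
  define B where "B = generate G (Y \<union> D)"
  have YD: "Y \<union> D \<subseteq> H" using insert.prems H by auto
  have B: "subgroup B G" unfolding B_def using YD HG by (intro generate_is_subgroup) auto
  have BH: "B \<subseteq> H" unfolding B_def by (rule generate_subgroup_incl[OF YD H(1)])
  have DB: "D \<subseteq> B" by (auto simp: B_def intro: generate.incl)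
  have sH: "s \<in> H" using insert.prems by simp
  note sG = HG[OF sH]
  have powH: "s [^] (k::nat) \<in> H" for k
    using sH by (induction k) (auto intro: subgroup.one_closed[OF H(1)] subgroup.m_closed[OF H(1)])
  \<comment> \<open>\<open>s\<close> normalizes \<open>B\<close> because commutators of elements of
    \<open>H\<close> lie in \<open>D\<close>. This lets the powers of \<open>s\<close> be collected
    on the right.\<close>
  have conj: "s [^] (k::nat) \<otimes> b \<otimes> inv (s [^] k) \<in> B" if b: "b \<in> B" for b k
  proof -
    have "s [^] k \<otimes> b \<otimes> inv (s [^] k) = commutator G (s [^] k) b \<otimes> b"
      using b BH HG sG by (simp add: m_assoc subset_iff)
    then show ?thesis
      using subgroup.m_closed[OF B subsetD[OF DB H(3)[OF powH[of k] subsetD[OF BH b]]] b] by simp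
  qed
  obtain F where F: "finite F" "F \<subseteq> H" "\<And>x. x \<in> B \<Longrightarrow> \<exists>d\<in>D. \<exists>f\<in>F. x = d \<otimes> f"
    using insert unfolding B_def by auto
  have *: "\<exists>b\<in>B. \<exists>k::nat. x = b \<otimes> s [^] k" if "x \<in> generate G (insert s Y \<union> D)" for x
    using that
  proof (induction rule: generate.induct)
    case one
    show ?case by (intro bexI[of _ \<one>] exI[of _ 0]) (auto simp: subgroup.one_closed[OF B])
  next
    case (incl h)
    then consider "h = s" | "h \<in> B" by (auto simp: B_def intro: generate.incl)
    then show ?case
    proof cases
      case 1
      then show ?thesis using sG by (intro bexI[of _ \<one>] exI[of _ 1]) (auto simp: subgroup.one_closed[OF B])
    next
      case 2
      then show ?thesis using HG BH by (intro bexI[of _ h] exI[of _ 0]) auto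
    qed
  next
    case (inv h)
    then consider "h = s" | "h \<in> B" by (auto simp: B_def intro: generate.incl)
    then show ?case
    proof cases
      case 1
      \<comment> \<open>Natural exponents suffice, since bounded exponent turns the inverse into a
        power.\<close>
      have "s [^] (n - 1) \<otimes> s = \<one>"
        using n(1) n(2)[OF sG] by (cases n) auto
      then have "inv s = s [^] (n - 1)" using sG by (simp add: inv_equality)
      then show ?thesis using 1 sG
        by (intro bexI[of _ \<one>] exI[of _ "n - 1"]) (auto simp: subgroup.one_closed[OF B])
    next
      case 2
      then show ?thesis using HG BH subgroup.m_inv_closed[OF B 2]
        by (intro bexI[of _ "inv h"] exI[of _ 0]) auto
    qed
  next
    case (eng h1 h2)
    then obtain b1 k1 b2 k2 where b: "b1 \<in> B" "h1 = b1 \<otimes> s [^] (k1::nat)" "b2 \<in> B" "h2 = b2 \<otimes> s [^] (k2::nat)"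
      by blast
    have bG: "b1 \<in> carrier G" "b2 \<in> carrier G" using b BH HG by auto
    have "h1 \<otimes> h2 = (b1 \<otimes> (s [^] k1 \<otimes> b2 \<otimes> inv (s [^] k1))) \<otimes> (s [^] k1 \<otimes> s [^] k2)"
      unfolding b using bG sG by (simp add: m_assoc, simp flip: m_assoc)
    also have "s [^] k1 \<otimes> s [^] k2 = s [^] (k1 + k2)" using sG by (rule nat_pow_mult)
    finally show ?case
      using subgroup.m_closed[OF B b(1) conj[OF b(3), of k1]] by blast
  qed
  \<comment> \<open>Reducing exponents modulo \<open>n\<close> leaves finitely many
    representatives.\<close>
  define F' where "F' = (\<lambda>(f, k). f \<otimes> s [^] (k::nat)) ` (F \<times> {..<n})"
  have "\<exists>d\<in>D. \<exists>f\<in>F'. x = d \<otimes> f" if x: "x \<in> generate G (insert s Y \<union> D)" for x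
  proof -
    obtain b k where b: "b \<in> B" "x = b \<otimes> s [^] (k::nat)" using *[OF x] by blast
    obtain d f where d: "d \<in> D" "f \<in> F" "b = d \<otimes> f" using F b by blast
    have "s [^] k = s [^] (n * (k div n) + k mod n)" by simp
    also have "\<dots> = (s [^] n) [^] (k div n) \<otimes> s [^] (k mod n)"
      using sG by (simp add: nat_pow_pow nat_pow_mult)
    also have "\<dots> = s [^] (k mod n)" using sG n(2) by simp
    finally have "x = d \<otimes> (f \<otimes> s [^] (k mod n))"
      using b d HG F(2) H(2) sG by (simp add: m_assoc subset_iff)
    moreover have "f \<otimes> s [^] (k mod n) \<in> F'" using d n(1) by (auto simp: F'_def)
    ultimately show ?thesis using d by blast
  qed
  moreover have "finite F'" using F by (simp add: F'_def)
  moreover have "F' \<subseteq> H" using F powH subgroup.m_closed[OF H(1)] by (auto simp: F'_def)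
  ultimately show ?case by blast
qed

text \<open>By Schreier's lemma \<open>H\<close> is finitely generated, so \<open>D\<close> has
  finite index in \<open>H\<close>. Products of representatives for \<open>D\<close> in
  \<open>H\<close> and for \<open>H\<close> in the group represent the cosets of
  \<open>D\<close>.\<close>

lemma (in group) finite_index_step:
  assumes S: "finite S" "S \<subseteq> carrier G" "generate G S = carrier G"
    and n: "n \<ge> 1" "\<And>x. x \<in> carrier G \<Longrightarrow> x [^] (n::nat) = \<one>"
    and H: "finite_index_subgroup G H" "\<And>x y. x \<in> H \<Longrightarrow> y \<in> H \<Longrightarrow> commutator G x y \<in> D"
    and D: "subgroup D G" "D \<subseteq> H"
  shows "finite_index_subgroup G D"
proof -
  have sub: "subgroup H G" using H by (simp add: finite_index_subgroup_def)
  have HG: "h \<in> carrier G" if "h \<in> H" for h using that by (rule subgroup.mem_carrier[OF sub])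
  obtain Y where Y: "finite Y" "Y \<subseteq> H" "generate G Y = H"
    using finitely_generated_finite_index[OF S H(1)] by blast
  obtain E where E: "finite E" "E \<subseteq> H" "\<And>x. x \<in> generate G (Y \<union> D) \<Longrightarrow> \<exists>d\<in>D. \<exists>f\<in>E. x = d \<otimes> f"
    using generate_insert_mod_cosets[OF D(1) n sub D(2) H(2) Y(1,2)] by blast
  obtain F where F: "finite F" "F \<subseteq> carrier G" "\<And>x. x \<in> carrier G \<Longrightarrow> \<exists>h\<in>H. \<exists>f\<in>F. x = h \<otimes> f"
    using H(1) finite_index_iff[OF sub] by (auto simp: finite_index_subgroup_def)
  define F' where "F' = (\<lambda>(e, f). e \<otimes> f) ` (E \<times> F)"
  have "\<exists>d\<in>D. \<exists>f\<in>F'. x = d \<otimes> f" if x: "x \<in> carrier G" for x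
  proof -
    obtain h f where h: "h \<in> H" "f \<in> F" "x = h \<otimes> f" using F x by blast
    have "h \<in> generate G (Y \<union> D)" using h Y(3) mono_generate[of Y "Y \<union> D"] by auto
    then obtain d e where d: "d \<in> D" "e \<in> E" "h = d \<otimes> e" using E by blast
    have "x = d \<otimes> (e \<otimes> f)"
      using h d HG E(2) F(2) D(2) by (simp add: m_assoc subset_iff)
    then show ?thesis using h d by (auto simp: F'_def)
  qed
  moreover have "finite F'" "F' \<subseteq> carrier G" using E(1,2) F(1,2) HG by (auto simp: F'_def subset_iff)
  ultimately show ?thesis
    using finite_index_iff[OF D(1)] D(1) unfolding finite_index_subgroup_def by blast
qed

section \<open>Finite index of the subgroups generated by powers\<close>

lemma (in group) power_subgroup_is_subgroup: "subgroup (power_subgroup G n) G"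
  unfolding power_subgroup_def by (rule generate_is_subgroup) auto

lemma (in group) power_subgroup_normal: "power_subgroup G n \<lhd> G"
  unfolding power_subgroup_def
proof (rule normal_generateI)
  fix h g assume "h \<in> {g [^] n | g. g \<in> carrier G}" and g: "g \<in> carrier G"
  then obtain x where "x \<in> carrier G" "h = x [^] n" by auto
  then show "g \<otimes> h \<otimes> inv g \<in> {g [^] n | g. g \<in> carrier G}"
    using g by (auto simp flip: conj_nat_pow)
qed auto

lemma finite_index_power_subgroup:
  assumes "group G" "finitely_generated G" "virtually_nilpotent G" "n \<ge> 1"
  shows "finite_index_subgroup G (power_subgroup G n)"
proof -
  interpret group G by fact
  define P where "P = power_subgroup G n"
  interpret P: normal P G unfolding P_def by (rule power_subgroup_normal)
  interpret \<pi>: group_hom G "G Mod P" "\<lambda>x. P #>\<^bsub>G\<^esub> x" by (rule P.group_hom_Mod)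
  obtain H where H: "finite_index_subgroup G H" "nilpotent_group (G\<lparr>carrier := H\<rparr>)"
    using assms by (auto simp: virtually_nilpotent_def)
  have sub: "subgroup H G" using H by (simp add: finite_index_subgroup_def)
  have HG: "h \<in> carrier G" if "h \<in> H" for h using that by (rule subgroup.mem_carrier[OF sub])
  interpret H: group "G\<lparr>carrier := H\<rparr>" by (rule subgroup_imp_group[OF sub])
  define D where "D = lower_central (G\<lparr>carrier := H\<rparr>)"
  have D_sub: "subgroup (D i) G" for i
    using H.lower_central_subgroup[of i] sub unfolding D_def by (rule incl_subgroup[rotated])
  have D_H: "D i \<subseteq> H" for i
    using subgroup.subset[OF H.lower_central_subgroup[of i]] by (simp add: D_def)
  have D_comm: "commutator G x y \<in> D (Suc i)" if "x \<in> D i" "y \<in> D i" for x y i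
  proof -
    have "x \<in> H" "y \<in> H" using that D_H by auto
    then have "commutator G x y = commutator (G\<lparr>carrier := H\<rparr>) x y"
      using m_inv_consistent[OF sub] by simp
    then show ?thesis using that \<open>y \<in> H\<close> unfolding D_def by (auto intro!: generate.incl)
  qed
  obtain c where c: "D c = {\<one>\<^bsub>G\<^esub>}" using H by (auto simp: nilpotent_group_def D_def)
  obtain S where S: "finite S" "S \<subseteq> carrier G" "generate G S = carrier G"
    using assms by (auto simp: finitely_generated_def)
  have S': "finite ((\<lambda>x. P #>\<^bsub>G\<^esub> x) ` S)" "(\<lambda>x. P #>\<^bsub>G\<^esub> x) ` S \<subseteq> carrier (G Mod P)"
    "generate (G Mod P) ((\<lambda>x. P #>\<^bsub>G\<^esub> x) ` S) = carrier (G Mod P)"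
    using S \<pi>.generate_img[OF S(2)] by (auto simp: carrier_FactGroup)
  have exponent: "X [^]\<^bsub>G Mod P\<^esub> n = \<one>\<^bsub>G Mod P\<^esub>" if X: "X \<in> carrier (G Mod P)" for X
  proof -
    obtain x where x: "x \<in> carrier G" "X = P #>\<^bsub>G\<^esub> x" using X by (auto simp: carrier_FactGroup)
    have "x [^]\<^bsub>G\<^esub> n \<in> P" using x by (auto simp: P_def power_subgroup_def intro: generate.incl)
    then have "P #>\<^bsub>G\<^esub> x [^]\<^bsub>G\<^esub> n = \<one>\<^bsub>G Mod P\<^esub>"
      using x by (subst P.coset_eq_one_iff) auto
    then show ?thesis using x by (simp add: \<pi>.hom_nat_pow)
  qed
  \<comment> \<open>The base case holds since \<open>D 0\<close> is \<open>H\<close>; each step uses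
    that \<open>G Mod P\<close> is finitely generated and of bounded exponent.\<close>
  have "finite_index_subgroup (G Mod P) ((\<lambda>x. P #>\<^bsub>G\<^esub> x) ` D i)" for i
  proof (induction i)
    case 0
    obtain F where F: "finite F" "F \<subseteq> carrier G" "\<And>x. x \<in> carrier G \<Longrightarrow> \<exists>h\<in>H. \<exists>f\<in>F. x = h \<otimes>\<^bsub>G\<^esub> f"
      using H(1) finite_index_iff[OF sub] by (auto simp: finite_index_subgroup_def)
    have sub': "subgroup ((\<lambda>x. P #>\<^bsub>G\<^esub> x) ` D 0) (G Mod P)"
      by (rule \<pi>.subgroup_img_is_subgroup[OF D_sub])
    have "\<exists>h\<in>(\<lambda>x. P #>\<^bsub>G\<^esub> x) ` D 0. \<exists>f\<in>(\<lambda>x. P #>\<^bsub>G\<^esub> x) ` F. X = h \<otimes>\<^bsub>G Mod P\<^esub> f"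
      if X: "X \<in> carrier (G Mod P)" for X
    proof -
      obtain x where x: "x \<in> carrier G" "X = P #>\<^bsub>G\<^esub> x" using X by (auto simp: carrier_FactGroup)
      obtain h f where hf: "h \<in> H" "f \<in> F" "x = h \<otimes>\<^bsub>G\<^esub> f" using F x by blast
      have "X = (P #>\<^bsub>G\<^esub> h) \<otimes>\<^bsub>G Mod P\<^esub> (P #>\<^bsub>G\<^esub> f)"
        unfolding x hf using HG hf F by (intro \<pi>.hom_mult) auto
      moreover have "h \<in> D 0" using hf by (simp add: D_def)
      ultimately show ?thesis using hf by blast
    qed
    moreover have "finite ((\<lambda>x. P #>\<^bsub>G\<^esub> x) ` F)" "(\<lambda>x. P #>\<^bsub>G\<^esub> x) ` F \<subseteq> carrier (G Mod P)"
      using F by (auto simp: carrier_FactGroup)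
    ultimately show ?case
      using \<pi>.H.finite_index_iff[OF sub'] sub' unfolding finite_index_subgroup_def by blast
  next
    case (Suc i)
    show ?case
    proof (rule \<pi>.H.finite_index_step[OF S' assms(4) exponent Suc])
      fix X Y assume XY: "X \<in> (\<lambda>x. P #>\<^bsub>G\<^esub> x) ` D i" "Y \<in> (\<lambda>x. P #>\<^bsub>G\<^esub> x) ` D i"
      obtain x y where xy: "x \<in> D i" "y \<in> D i" "X = P #>\<^bsub>G\<^esub> x" "Y = P #>\<^bsub>G\<^esub> y" using XY by auto
      have "x \<in> carrier G" "y \<in> carrier G" using xy D_H HG by auto
      then have "commutator (G Mod P) X Y = P #>\<^bsub>G\<^esub> commutator G x y"
        unfolding xy by (rule \<pi>.hom_commutator[symmetric])
      then show "commutator (G Mod P) X Y \<in> (\<lambda>x. P #>\<^bsub>G\<^esub> x) ` D (Suc i)"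
        using D_comm[OF xy(1,2)] by blast
    next
      show "subgroup ((\<lambda>x. P #>\<^bsub>G\<^esub> x) ` D (Suc i)) (G Mod P)"
        by (rule \<pi>.subgroup_img_is_subgroup[OF D_sub])
      show "(\<lambda>x. P #>\<^bsub>G\<^esub> x) ` D (Suc i) \<subseteq> (\<lambda>x. P #>\<^bsub>G\<^esub> x) ` D i"
        unfolding D_def by (intro image_mono H.lower_central_decreasing)
    qed
  qed
  \<comment> \<open>The series ends trivially, so the trivial subgroup has finite index and
    \<open>G Mod P\<close> is finite.\<close>
  from this[of c] have fi: "finite_index_subgroup (G Mod P) {\<one>\<^bsub>G Mod P\<^esub>}"
    using \<pi>.hom_one by (simp add: c)
  then obtain F where F: "finite F" "F \<subseteq> carrier (G Mod P)"
    "\<forall>X\<in>carrier (G Mod P). \<exists>h\<in>{\<one>\<^bsub>G Mod P\<^esub>}. \<exists>f\<in>F. X = h \<otimes>\<^bsub>G Mod P\<^esub> f"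
    using \<pi>.H.finite_index_iff[OF \<pi>.H.triv_subgroup] unfolding finite_index_subgroup_def by blast
  have "carrier (G Mod P) \<subseteq> F"
  proof
    fix X assume "X \<in> carrier (G Mod P)"
    then obtain f where "f \<in> F" "X = \<one>\<^bsub>G Mod P\<^esub> \<otimes>\<^bsub>G Mod P\<^esub> f" using F(3) by blast
    then show "X \<in> F" using F(2) \<pi>.H.l_one[of f] by (metis subsetD)
  qed
  then have "finite (carrier (G Mod P))" using F(1) finite_subset by blast
  then show ?thesis
    using power_subgroup_is_subgroup
    by (simp add: finite_index_subgroup_def FactGroup_def P_def)
qed

text \<open>If all \<open>d\<close>-th powers lie in \<open>H\<close>, a power with exponent
  \<open>d * M\<close> is an \<open>M\<close>-th power of an element of \<open>H\<close>, and the
  nilpotent case applies to \<open>H\<close>.\<close>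

lemma virtually_nilpotent_products_of_powers:
  assumes "group G" "virtually_nilpotent G" "n \<ge> 1"
  shows "\<exists>K\<ge>1. power_subgroup G K \<subseteq> {a [^]\<^bsub>G\<^esub> (n::nat) | a. a \<in> carrier G}"
proof -
  interpret group G by fact
  obtain H where H: "finite_index_subgroup G H" "nilpotent_group (G\<lparr>carrier := H\<rparr>)"
    using assms by (auto simp: virtually_nilpotent_def)
  have sub: "subgroup H G" using H by (simp add: finite_index_subgroup_def)
  have HG: "h \<in> carrier G" if "h \<in> H" for h using that by (rule subgroup.mem_carrier[OF sub])
  obtain d where d: "d \<ge> 1" "\<And>g. g \<in> carrier G \<Longrightarrow> g [^]\<^bsub>G\<^esub> (d::nat) \<in> H"
    using finite_index_pow_mem[OF H(1)] by blast
  obtain M :: nat where M: "M \<ge> 1" "power_subgroup (G\<lparr>carrier := H\<rparr>) M \<subseteq> {a [^]\<^bsub>G\<^esub> n | a. a \<in> H}"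
    using nilpotent_group_products_of_powers[OF H(2) assms(3)] by (auto simp flip: nat_pow_consistent)
  have "power_subgroup G (d * M) \<subseteq> generate G {h [^]\<^bsub>G\<^esub> M | h. h \<in> H}"
    unfolding power_subgroup_def
  proof (rule mono_generate, safe)
    fix g assume "g \<in> carrier G"
    then show "\<exists>h. g [^]\<^bsub>G\<^esub> (d * M) = h [^]\<^bsub>G\<^esub> M \<and> h \<in> H"
      using d(2) by (intro exI[of _ "g [^]\<^bsub>G\<^esub> d"]) (simp add: nat_pow_pow)
  qed
  also have "\<dots> = power_subgroup (G\<lparr>carrier := H\<rparr>) M"
  proof -
    have "{h [^]\<^bsub>G\<^esub> M | h. h \<in> H} \<subseteq> H"
      using group.is_monoid[OF subgroup_imp_group[OF sub], THEN monoid.nat_pow_closed]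
      by (auto simp flip: nat_pow_consistent)
    then show ?thesis
      unfolding power_subgroup_def by (simp add: generate_consistent[OF _ sub] flip: nat_pow_consistent)
  qed
  also have "\<dots> \<subseteq> {a [^]\<^bsub>G\<^esub> n | a. a \<in> H}" by (rule M(2))
  also have "\<dots> \<subseteq> {a [^]\<^bsub>G\<^esub> n | a. a \<in> carrier G}" using HG by blast
  finally have "power_subgroup G (d * M) \<subseteq> {a [^]\<^bsub>G\<^esub> n | a. a \<in> carrier G}" .
  moreover have "d * M \<ge> 1" using d M by simp
  ultimately show ?thesis by blast
qed

section \<open>Verbal subgroups of bounded width\<close>

text \<open>Bounding the number of factors makes the set first-order expressible; splitting off the
  left factor matches the recursion of \<open>pow_products_formula\<close>.\<close>

fun pow_products :: "('a, 'b) monoid_scheme \<Rightarrow> nat \<Rightarrow> nat \<Rightarrow> 'a set" where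
  "pow_products G n 0 = {\<one>\<^bsub>G\<^esub>}"
| "pow_products G n (Suc k) =
     {y [^]\<^bsub>G\<^esub> n \<otimes>\<^bsub>G\<^esub> z | y z. y \<in> carrier G \<and> z \<in> pow_products G n k}"

context group
begin

lemma pow_products_subset: "pow_products G n k \<subseteq> power_subgroup G n"
proof (induction k)
  case 0
  show ?case by (simp add: power_subgroup_def generate.one)
next
  case (Suc k)
  have "y [^] n \<in> power_subgroup G n" if "y \<in> carrier G" for y
    using that by (auto simp: power_subgroup_def intro: generate.incl)
  then show ?case
    using Suc subgroup.m_closed[OF power_subgroup_is_subgroup] by auto
qed

lemma pow_products_carrier: "x \<in> pow_products G n k \<Longrightarrow> x \<in> carrier G"
  by (rule subgroup.mem_carrier[OF power_subgroup_is_subgroup subsetD[OF pow_products_subset]])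

lemma pow_products_mult:
  assumes "x \<in> pow_products G n i" "y \<in> pow_products G n j"
  shows "x \<otimes> y \<in> pow_products G n (i + j)"
  using assms(1)
proof (induction i arbitrary: x)
  case 0
  then show ?case using pow_products_carrier[OF assms(2)] assms(2) by simp
next
  case (Suc i)
  then obtain u z where uz: "u \<in> carrier G" "z \<in> pow_products G n i" "x = u [^] n \<otimes> z" by auto
  then have "x \<otimes> y = u [^] n \<otimes> (z \<otimes> y)"
    using pow_products_carrier assms(2) by (simp add: m_assoc)
  then show ?case using Suc.IH[OF uz(2)] uz(1) by auto
qed

text \<open>Shorter products are padded with the factor \<open>\<one> [^] n\<close>.\<close>

lemma pow_products_mono:
  assumes "i \<le> j"
  shows "pow_products G n i \<subseteq> pow_products G n j"
  using assms
proof (induction j rule: dec_induct)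
  case (step j)
  have "pow_products G n j \<subseteq> pow_products G n (Suc j)"
  proof
    fix x assume x: "x \<in> pow_products G n j"
    then have "x = \<one> [^] n \<otimes> x" using pow_products_carrier by simp
    then show "x \<in> pow_products G n (Suc j)" unfolding pow_products.simps using x by blast
  qed
  then show ?case using step by blast
qed simp

lemma pow_mem_pow_products: "x \<in> carrier G \<Longrightarrow> x [^] n \<in> pow_products G n 1"
  by (auto intro: exI[of _ x])

lemma power_subgroup_eq_Union: "power_subgroup G n = (\<Union>k. pow_products G n k)"
proof
  show "power_subgroup G n \<subseteq> (\<Union>k. pow_products G n k)"
  proof
    fix x assume "x \<in> power_subgroup G n"
    then have "x \<in> generate G {g [^] n | g. g \<in> carrier G}" by (simp add: power_subgroup_def)
    then show "x \<in> (\<Union>k. pow_products G n k)"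
    proof (induction rule: generate.induct)
      case one
      then show ?case by (intro UN_I[of 0]) auto
    next
      case (incl h)
      then show ?case using pow_mem_pow_products by blast
    next
      case (inv h)
      then obtain g where "g \<in> carrier G" "h = g [^] n" by auto
      then have "inv h \<in> pow_products G n 1"
        using pow_mem_pow_products[of "inv g" n] by (simp add: nat_pow_inv del: pow_products.simps)
      then show ?case by blast
    next
      case (eng h1 h2)
      then show ?case using pow_products_mult by blast
    qed
  qed
qed (use pow_products_subset in blast)

text \<open>Each of the finitely many representatives lying in the subgroup generated by the powers is
  a product of finitely many of them, which bounds the width.\<close>

lemma power_subgroup_bounded_width:
  assumes F: "finite F" "F \<subseteq> carrier G"
    and cover: "\<And>x. x \<in> carrier G \<Longrightarrow> \<exists>y\<in>carrier G. \<exists>f\<in>F. x = y [^] (n::nat) \<otimes> f"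
  shows "\<exists>k. power_subgroup G n = pow_products G n k"
proof -
  have "\<exists>k. F' \<subseteq> pow_products G n k" if "finite F'" "F' \<subseteq> power_subgroup G n" for F'
    using that
  proof (induction F' rule: finite_induct)
    case (insert f F')
    then obtain k i where "F' \<subseteq> pow_products G n k" "f \<in> pow_products G n i"
      by (auto simp: power_subgroup_eq_Union)
    then have "insert f F' \<subseteq> pow_products G n (max k i)"
      using pow_products_mono[of k "max k i" n] pow_products_mono[of i "max k i" n] by auto
    then show ?case by blast
  qed auto
  then obtain k where k: "F \<inter> power_subgroup G n \<subseteq> pow_products G n k"
    using F by (meson finite_Int inf_le2)
  have "power_subgroup G n \<subseteq> pow_products G n (Suc k)"
  proof
    fix x assume x: "x \<in> power_subgroup G n"
    then have "x \<in> carrier G" by (rule subgroup.mem_carrier[OF power_subgroup_is_subgroup])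
    then obtain y f where yf: "y \<in> carrier G" "f \<in> F" "x = y [^] n \<otimes> f" using cover by blast
    have yP: "y [^] n \<in> power_subgroup G n"
      using yf by (auto simp: power_subgroup_def intro!: generate.incl)
    have "f = inv (y [^] n) \<otimes> x"
      using yf F by (auto simp: subset_iff simp flip: m_assoc)
    then have "f \<in> power_subgroup G n"
      using x yP power_subgroup_is_subgroup by (simp add: subgroup.m_closed subgroup.m_inv_closed)
    then show "x \<in> pow_products G n (Suc k)" using k yf by auto
  qed
  then show ?thesis using pow_products_subset[of n "Suc k"] by blast
qed

lemma finite_index_of_cover:
  assumes F: "finite F" "F \<subseteq> carrier G"
    and cover: "\<And>x. x \<in> carrier G \<Longrightarrow> \<exists>y\<in>carrier G. \<exists>f\<in>F. x = y [^] (n::nat) \<otimes> f"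
  shows "finite_index_subgroup G (power_subgroup G n)"
proof -
  have "\<exists>h\<in>power_subgroup G n. \<exists>f\<in>F. x = h \<otimes> f" if x: "x \<in> carrier G" for x
  proof -
    obtain y f where "y \<in> carrier G" "f \<in> F" "x = y [^] n \<otimes> f" using cover[OF x] by blast
    moreover from this have "y [^] n \<in> power_subgroup G n"
      by (auto simp: power_subgroup_def intro!: generate.incl)
    ultimately show ?thesis by blast
  qed
  then show ?thesis
    using F finite_index_iff[OF power_subgroup_is_subgroup, of n] power_subgroup_is_subgroup[of n]
    unfolding finite_index_subgroup_def by blast
qed

lemma power_subgroup_dvd:
  assumes "n dvd k"
  shows "power_subgroup G k \<subseteq> power_subgroup G n"
  unfolding power_subgroup_def
proof (rule mono_generate, safe)
  fix g assume g: "g \<in> carrier G"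
  obtain l where "k = n * l" using assms by auto
  then show "\<exists>h. g [^] k = h [^] n \<and> h \<in> carrier G"
    using g by (intro exI[of _ "g [^] l"]) (simp add: nat_pow_pow mult.commute)
qed

text \<open>Makes the subgroups generated by powers cofinal among all subgroups of finite index,
  which bounds the connected components from below.\<close>

lemma finite_index_contains_power_subgroup:
  assumes "finite_index_subgroup G H"
  shows "\<exists>n\<ge>1. power_subgroup G n \<subseteq> H"
proof -
  obtain d where d: "d \<ge> 1" "\<forall>g\<in>carrier G. g [^] (d::nat) \<in> H"
    using finite_index_pow_mem[OF assms] by blast
  have "power_subgroup G d \<subseteq> H"
    unfolding power_subgroup_def
    using assms d by (intro generate_subgroup_incl) (auto simp: finite_index_subgroup_def)
  then show ?thesis using d by blast
qed

end

text \<open>Some \<open>power_subgroup G K\<close> has finite index and consists of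
  \<open>n\<close>-th powers. A cover by single powers, rather than by elements of a generated
  subgroup, can be stated by one formula.\<close>

lemma virtually_nilpotent_power_cover:
  assumes "group G" "finitely_generated G" "virtually_nilpotent G" "n \<ge> 1"
  shows "\<exists>F. finite F \<and> F \<subseteq> carrier G \<and>
    (\<forall>x\<in>carrier G. \<exists>y\<in>carrier G. \<exists>f\<in>F. x = y [^]\<^bsub>G\<^esub> (n::nat) \<otimes>\<^bsub>G\<^esub> f)"
proof -
  interpret group G by fact
  obtain K :: nat where K: "K \<ge> 1" "power_subgroup G K \<subseteq> {a [^]\<^bsub>G\<^esub> n | a. a \<in> carrier G}"
    using virtually_nilpotent_products_of_powers[OF assms(1,3,4)] by blast
  obtain F where F: "finite F" "F \<subseteq> carrier G"
    "\<forall>x\<in>carrier G. \<exists>h\<in>power_subgroup G K. \<exists>f\<in>F. x = h \<otimes>\<^bsub>G\<^esub> f"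
    using finite_index_power_subgroup[OF assms(1-3) K(1)] finite_index_iff[OF power_subgroup_is_subgroup, of K]
    unfolding finite_index_subgroup_def by blast
  show ?thesis
  proof (intro exI[of _ F] conjI ballI F(1,2))
    fix x assume "x \<in> carrier G"
    then obtain h f where hf: "h \<in> power_subgroup G K" "f \<in> F" "x = h \<otimes>\<^bsub>G\<^esub> f" using F(3) by blast
    then obtain y where "y \<in> carrier G" "h = y [^]\<^bsub>G\<^esub> n" using K(2) by blast
    then show "\<exists>y\<in>carrier G. \<exists>f\<in>F. x = y [^]\<^bsub>G\<^esub> n \<otimes>\<^bsub>G\<^esub> f" using hf by blast
  qed
qed

section \<open>First-order formulas about powers\<close>

lemma carrier_group_of [simp]: "carrier (group_of m M) = universe M"
  and mult_group_of [simp]: "x \<otimes>\<^bsub>group_of m M\<^esub> y = fun_interp M m [x, y]"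
  by (simp_all add: group_of_def)

definition Forall :: "nat \<Rightarrow> ('f, 'r) fo_formula \<Rightarrow> ('f, 'r) fo_formula" where
  "Forall i \<phi> = Neg (Exists i (Neg \<phi>))"

lemma sat_Forall [simp]: "sat M v (Forall i \<phi>) \<longleftrightarrow> (\<forall>x\<in>universe M. sat M (v(i := x)) \<phi>)"
  and formula_in_Forall [simp]: "formula_in L (Forall i \<phi>) \<longleftrightarrow> formula_in L \<phi>"
  by (simp_all add: Forall_def)

abbreviation mult_term :: "'f \<Rightarrow> 'f fo_term \<Rightarrow> 'f fo_term \<Rightarrow> 'f fo_term" where
  "mult_term m s t \<equiv> Apply m [s, t]"

text \<open>The term \<open>pow_term m i n\<close> denotes the power with exponent \<open>n + 1\<close>, since the language
  need not contain a symbol for the unit. The exponent in the formulas below is shifted likewise.\<close>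

fun pow_term :: "'f \<Rightarrow> nat \<Rightarrow> nat \<Rightarrow> 'f fo_term" where
  "pow_term m i 0 = Variable i"
| "pow_term m i (Suc n) = mult_term m (pow_term m i n) (Variable i)"

text \<open>Continuing with variable \<open>i + 2\<close> avoids capture. With no factors left,
  \<open>x x = x\<close> expresses that \<open>x\<close> is the unit.\<close>

fun pow_products_formula :: "'f \<Rightarrow> nat \<Rightarrow> nat \<Rightarrow> nat \<Rightarrow> ('f, 'r) fo_formula" where
  "pow_products_formula m n 0 i = Equal (mult_term m (Variable i) (Variable i)) (Variable i)"
| "pow_products_formula m n (Suc k) i =
     Exists (Suc i) (Exists (Suc (Suc i))
       (Conj (Equal (Variable i) (mult_term m (pow_term m (Suc i) n) (Variable (Suc (Suc i)))))
         (pow_products_formula m n k (Suc (Suc i)))))"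

text \<open>A disjunction over \<open>r\<close> representatives, held by the variables from 2 on;
  variable 0 is the element to be covered and variable 1 the root.\<close>

fun cover_formula :: "'f \<Rightarrow> nat \<Rightarrow> nat \<Rightarrow> ('f, 'r) fo_formula" where
  "cover_formula m n 0 = Neg (Equal (Variable 0) (Variable 0))"
| "cover_formula m n (Suc r) =
     Neg (Conj (Neg (cover_formula m n r))
       (Neg (Exists 1 (Equal (Variable 0) (mult_term m (pow_term m 1 n) (Variable (r + 2)))))))"

lemma term_in_pow_term: "expands_group_language L m \<Longrightarrow> term_in L (pow_term m i n)"
  by (induction n) (auto simp: expands_group_language_def)

lemma term_vars_pow_term: "term_vars (pow_term m i n) = {i}"
  by (induction n) auto

lemma formula_in_pow_products_formula:
  "expands_group_language L m \<Longrightarrow> formula_in L (pow_products_formula m n k i)"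
  by (induction k arbitrary: i) (auto simp: expands_group_language_def intro!: term_in_pow_term)

lemma free_vars_pow_products_formula: "free_vars (pow_products_formula m n k i) = {i}"
  by (induction k arbitrary: i) (auto simp: term_vars_pow_term)

lemma formula_in_cover_formula:
  "expands_group_language L m \<Longrightarrow> formula_in L (cover_formula m n r)"
  by (induction r) (auto simp: expands_group_language_def intro!: term_in_pow_term)

context
  fixes m :: 'f and M :: "('a, 'f, 'r) fo_struct"
  assumes grp: "group (group_of m M)"
begin

interpretation M: group "group_of m M" by (rule grp)

lemma eval_pow_term:
  assumes "v i \<in> universe M"
  shows "eval_term M v (pow_term m i n) = v i [^]\<^bsub>group_of m M\<^esub> Suc n"
proof (induction n)
  case 0
  show ?case using M.l_one[of "v i"] assms by simp
next
  case (Suc n)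
  have "eval_term M v (pow_term m i (Suc n)) = eval_term M v (pow_term m i n) \<otimes>\<^bsub>group_of m M\<^esub> v i"
    by simp
  then show ?case unfolding Suc by simp
qed

lemma sat_pow_products_formula:
  assumes "v i \<in> universe M"
  shows "sat M v (pow_products_formula m n k i) \<longleftrightarrow> v i \<in> pow_products (group_of m M) (Suc n) k"
  using assms
proof (induction k arbitrary: v i)
  case 0
  then show ?case
    using M.l_cancel_one[of "v i" "v i"] by simp
next
  case (Suc k)
  have "sat M v (pow_products_formula m n (Suc k) i) \<longleftrightarrow> (\<exists>y\<in>universe M. \<exists>z\<in>universe M.
      v i = y [^]\<^bsub>group_of m M\<^esub> Suc n \<otimes>\<^bsub>group_of m M\<^esub> z \<and> z \<in> pow_products (group_of m M) (Suc n) k)"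
    by (simp add: eval_pow_term Suc.IH del: nat_pow_Suc)
  also have "\<dots> \<longleftrightarrow> v i \<in> pow_products (group_of m M) (Suc n) (Suc k)"
    using M.pow_products_carrier[of _ "Suc n" k] by (auto simp del: nat_pow_Suc)
  finally show ?case .
qed

lemma sat_cover_formula:
  assumes "v 0 \<in> universe M"
  shows "sat M v (cover_formula m n r) \<longleftrightarrow>
    (\<exists>i<r. \<exists>y\<in>universe M. v 0 = y [^]\<^bsub>group_of m M\<^esub> Suc n \<otimes>\<^bsub>group_of m M\<^esub> v (i + 2))"
  using assms by (induction r) (auto simp: eval_pow_term less_Suc_eq simp del: nat_pow_Suc)

end

section \<open>Transfer of the group axioms\<close>

lemma elementary_sat_iff:
  assumes "elementary_extension L G Gs" "formula_in L \<phi>" "\<And>i. v i \<in> universe G"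
  shows "sat G v \<phi> \<longleftrightarrow> sat Gs v \<phi>"
proof -
  have "range v \<subseteq> universe G" using assms(3) by auto
  then show ?thesis using assms(1,2) unfolding elementary_extension_def by blast
qed

text \<open>The unit of \<open>group_of\<close> is a definite description. The axioms are therefore
  checked for a copy \<open>K\<close> with explicit unit \<open>e\<close>, and uniqueness of
  two-sided units identifies the two.\<close>

lemma group_ofI:
  assumes closed: "\<And>x y. x \<in> universe M \<Longrightarrow> y \<in> universe M \<Longrightarrow> fun_interp M m [x, y] \<in> universe M"
    and assoc: "\<And>x y z. x \<in> universe M \<Longrightarrow> y \<in> universe M \<Longrightarrow> z \<in> universe M \<Longrightarrow>
      fun_interp M m [fun_interp M m [x, y], z] = fun_interp M m [x, fun_interp M m [y, z]]"
    and e: "e \<in> universe M" "\<And>x. x \<in> universe M \<Longrightarrow> fun_interp M m [e, x] = x"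
    and inv: "\<And>x. x \<in> universe M \<Longrightarrow> \<exists>y\<in>universe M. fun_interp M m [y, x] = e"
  shows "group (group_of m M)"
proof -
  define K where "K = \<lparr>carrier = universe M, monoid.mult = (\<lambda>x y. fun_interp M m [x, y]), one = e\<rparr>"
  have "group K"
    by (rule groupI) (use assms in \<open>auto simp: K_def\<close>)
  then interpret K: group K .
  have "(THE e. e \<in> universe M \<and>
      (\<forall>x \<in> universe M. fun_interp M m [e, x] = x \<and> fun_interp M m [x, e] = x)) = e"
  proof (rule the_equality)
    have "fun_interp M m [x, e] = x" if "x \<in> universe M" for x
      using K.r_one[of x] that by (simp add: K_def)
    then show "e \<in> universe M \<and> (\<forall>x \<in> universe M. fun_interp M m [e, x] = x \<and> fun_interp M m [x, e] = x)"
      using e by blast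
    then show "e' = e" if "e' \<in> universe M \<and>
        (\<forall>x \<in> universe M. fun_interp M m [e', x] = x \<and> fun_interp M m [x, e'] = x)" for e'
      using that by metis
  qed
  then have "group_of m M = K" by (simp add: group_of_def K_def)
  then show ?thesis using \<open>group K\<close> by simp
qed

lemma elementary_extension_group:
  fixes L :: "('f, 'r) language" and G Gs :: "('a, 'f, 'r) fo_struct"
  assumes L: "expands_group_language L m"
    and G: "group (group_of m G)"
    and el: "elementary_extension L G Gs"
  shows "group (group_of m Gs)"
proof -
  interpret G: group "group_of m G" by fact
  define v where "v = (\<lambda>i::nat. \<one>\<^bsub>group_of m G\<^esub>)"
  have v: "v i \<in> universe G" for i using G.one_closed by (simp add: v_def)
  have m: "m \<in> fun_syms L" "fun_arity L m = 2" using L by (auto simp: expands_group_language_def)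
  have Gs: "is_structure L Gs" using el by (simp add: elementary_extension_def substructure_def)
  define assoc where "assoc = Forall 0 (Forall 1 (Forall 2 (Equal
    (mult_term m (mult_term m (Variable 0) (Variable 1)) (Variable 2))
    (mult_term m (Variable 0) (mult_term m (Variable 1) (Variable 2)))))
    :: ('f, 'r) fo_formula)"
  \<comment> \<open>Without a constant for the unit, the existence of inverses must stand in the
    scope of the quantifier for the unit.\<close>
  define unit where "unit = Exists 0 (Forall 1 (Conj
    (Equal (mult_term m (Variable 0) (Variable 1)) (Variable 1))
    (Exists 2 (Equal (mult_term m (Variable 2) (Variable 1)) (Variable 0)))) :: ('f, 'r) fo_formula)"
  have "sat G v assoc" using G.m_assoc by (simp add: assoc_def)
  then have assoc: "sat Gs v assoc"
    using elementary_sat_iff[OF el, of assoc v] v m by (simp add: assoc_def)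
  have "sat G v unit"
    using G.l_inv_ex G.l_one G.one_closed unfolding unit_def sat.simps(5)
    by (intro bexI[of _ "\<one>\<^bsub>group_of m G\<^esub>"]) auto
  then have "sat Gs v unit"
    using elementary_sat_iff[OF el, of unit v] v m by (simp add: unit_def)
  then obtain e where e: "e \<in> universe Gs"
    "\<forall>x\<in>universe Gs. fun_interp Gs m [e, x] = x \<and> (\<exists>y\<in>universe Gs. fun_interp Gs m [y, x] = e)"
    by (auto simp: unit_def)
  show ?thesis
  proof (rule group_ofI[where e = e])
    show "fun_interp Gs m [x, y] \<in> universe Gs" if "x \<in> universe Gs" "y \<in> universe Gs" for x y
      using Gs m that by (simp add: is_structure_def)
  qed (use e assoc in \<open>auto simp: assoc_def\<close>)
qed

section \<open>The connected component of an elementary extension\<close>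

locale elementary_power_extension =
  fixes L :: "('f, 'r) language" and m :: 'f and G Gs :: "('a, 'f, 'r) fo_struct"
  assumes L: "expands_group_language L m"
    and group_G: "group (group_of m G)"
    and fg: "finitely_generated (group_of m G)"
    and vn: "virtually_nilpotent (group_of m G)"
    and el: "elementary_extension L G Gs"
begin

sublocale G: group "group_of m G" by (rule group_G)
sublocale Gs: group "group_of m Gs" by (rule elementary_extension_group[OF L group_G el])

text \<open>The representatives found in \<open>G\<close> become parameters of a formula true in
  \<open>G\<close>, so the same finite set works in \<open>Gs\<close>.\<close>

lemma power_cover:
  assumes "n \<ge> 1"
  shows "\<exists>F. finite F \<and> F \<subseteq> universe Gs \<and>
    (\<forall>x\<in>universe Gs. \<exists>y\<in>universe Gs. \<exists>f\<in>F. x = y [^]\<^bsub>group_of m Gs\<^esub> (n::nat) \<otimes>\<^bsub>group_of m Gs\<^esub> f)"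
proof -
  obtain p where n: "n = Suc p" using assms by (cases n) auto
  obtain F where F: "finite F" "F \<subseteq> universe G"
    "\<forall>x\<in>universe G. \<exists>y\<in>universe G. \<exists>f\<in>F. x = y [^]\<^bsub>group_of m G\<^esub> n \<otimes>\<^bsub>group_of m G\<^esub> f"
    using virtually_nilpotent_power_cover[OF group_G fg vn assms] by auto
  obtain fs where fs: "set fs = F" using F finite_list by blast
  \<comment> \<open>Variables 0 and 1 are bound in the formula, hence the shift by 2. The unit is a
    default that keeps the whole valuation inside \<open>G\<close>.\<close>
  define v where "v = (\<lambda>i. if i < 2 \<or> i \<ge> length fs + 2 then \<one>\<^bsub>group_of m G\<^esub> else fs ! (i - 2))"
  have v: "v i \<in> universe G" for i
    using G.one_closed F(2) fs nth_mem[of "i - 2" fs] by (auto simp: v_def)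
  have vi: "v (i + 2) = fs ! i" if "i < length fs" for i
    using that by (simp add: v_def)
  have FGs: "F \<subseteq> universe Gs" using F(2) el by (auto simp: elementary_extension_def substructure_def)
  have iff: "sat M v (Forall 0 (cover_formula m p (length fs))) \<longleftrightarrow> (\<forall>x\<in>universe M. \<exists>y\<in>universe M. \<exists>f\<in>F.
      x = y [^]\<^bsub>group_of m M\<^esub> n \<otimes>\<^bsub>group_of m M\<^esub> f)" if "group (group_of m M)" for M :: "('a, 'f, 'r) fo_struct"
  proof -
    have "sat M v (Forall 0 (cover_formula m p (length fs))) \<longleftrightarrow> (\<forall>x\<in>universe M.
        \<exists>i<length fs. \<exists>y\<in>universe M. x = y [^]\<^bsub>group_of m M\<^esub> n \<otimes>\<^bsub>group_of m M\<^esub> v (i + 2))"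
      using sat_cover_formula[OF that] by (simp add: n del: nat_pow_Suc)
    also have "\<dots> \<longleftrightarrow> (\<forall>x\<in>universe M. \<exists>y\<in>universe M. \<exists>f\<in>F.
      x = y [^]\<^bsub>group_of m M\<^esub> n \<otimes>\<^bsub>group_of m M\<^esub> f)"
      using vi by (simp add: fs[symmetric] in_set_conv_nth Bex_def) (metis (no_types, lifting))
    finally show ?thesis .
  qed
  have "sat Gs v (Forall 0 (cover_formula m p (length fs)))"
    using elementary_sat_iff[OF el, of "Forall 0 (cover_formula m p (length fs))" v] v F(3)
      iff[OF group_G] formula_in_cover_formula[OF L] by simp
  then show ?thesis
    using iff[OF Gs.is_group] F FGs by blast
qed

text \<open>For each number \<open>k\<close> of factors the inclusion is a sentence true in
  \<open>G\<close>. As \<open>K\<close> is the same for all \<open>k\<close>, the transferred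
  inclusions add up to the generated subgroup.\<close>

lemma powers_of_power_subgroup:
  assumes "n \<ge> 1"
  shows "\<exists>K\<ge>1. power_subgroup (group_of m Gs) K \<subseteq> {a [^]\<^bsub>group_of m Gs\<^esub> (n::nat) | a. a \<in> universe Gs}"
proof -
  obtain p where n: "n = Suc p" using assms by (cases n) auto
  obtain K where K: "K \<ge> 1" "power_subgroup (group_of m G) K \<subseteq> {a [^]\<^bsub>group_of m G\<^esub> n | a. a \<in> universe G}"
    using virtually_nilpotent_products_of_powers[OF group_G vn assms] by auto
  obtain q where q: "K = Suc q" using K by (cases K) auto
  have "pow_products (group_of m Gs) K k \<subseteq> {a [^]\<^bsub>group_of m Gs\<^esub> n | a. a \<in> universe Gs}" for k
  proof -
    define \<phi> :: "('f, 'r) fo_formula" where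
      "\<phi> = Forall 0 (Neg (Conj (pow_products_formula m q k 0)
        (Neg (Exists 1 (Equal (Variable 0) (pow_term m 1 p))))))"
    define v where "v = (\<lambda>i::nat. \<one>\<^bsub>group_of m G\<^esub>)"
    have v: "v i \<in> universe G" for i using G.one_closed by (simp add: v_def)
    have iff: "sat M v \<phi> \<longleftrightarrow>
        (\<forall>x\<in>universe M. x \<in> pow_products (group_of m M) K k \<longrightarrow> (\<exists>y\<in>universe M. x = y [^]\<^bsub>group_of m M\<^esub> n))"
      if "group (group_of m M)" for M :: "('a, 'f, 'r) fo_struct"
      using sat_pow_products_formula[OF that] eval_pow_term[OF that]
      by (simp add: \<phi>_def n q del: nat_pow_Suc)
    have "sat G v \<phi>"
      unfolding iff[OF group_G] using K(2) G.pow_products_subset[of K k] by blast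
    moreover have "formula_in L \<phi>"
      using formula_in_pow_products_formula[OF L] term_in_pow_term[OF L] by (simp add: \<phi>_def)
    ultimately have "sat Gs v \<phi>"
      using elementary_sat_iff[OF el] v by blast
    then show ?thesis
      unfolding iff[OF Gs.is_group] using Gs.pow_products_carrier[of _ K k] by auto
  qed
  then show ?thesis using K(1) Gs.power_subgroup_eq_Union[of K] by blast
qed

lemma power_subgroup_width:
  assumes "n \<ge> 1"
  shows "\<exists>k. power_subgroup (group_of m Gs) n = pow_products (group_of m Gs) n k"
proof -
  obtain F where "finite F" "F \<subseteq> universe Gs" "\<forall>x\<in>universe Gs. \<exists>y\<in>universe Gs. \<exists>f\<in>F.
      x = y [^]\<^bsub>group_of m Gs\<^esub> n \<otimes>\<^bsub>group_of m Gs\<^esub> f"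
    using power_cover[OF assms] by blast
  then show ?thesis by (intro Gs.power_subgroup_bounded_width[of F]) simp_all
qed

lemma power_subgroup_finite_index:
  assumes "n \<ge> 1"
  shows "finite_index_subgroup (group_of m Gs) (power_subgroup (group_of m Gs) n)"
proof -
  obtain F where "finite F" "F \<subseteq> universe Gs" "\<forall>x\<in>universe Gs. \<exists>y\<in>universe Gs. \<exists>f\<in>F.
      x = y [^]\<^bsub>group_of m Gs\<^esub> n \<otimes>\<^bsub>group_of m Gs\<^esub> f"
    using power_cover[OF assms] by blast
  then show ?thesis by (intro Gs.finite_index_of_cover[of F]) simp_all
qed

text \<open>Bounded width replaces the generated subgroup by one formula whose only free variable is
  0, so it is definable over any \<open>A\<close>.\<close>

lemma power_subgroup_definable:
  assumes "n \<ge> 1"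
  shows "definable L Gs A (power_subgroup (group_of m Gs) n)"
proof -
  obtain p where n: "n = Suc p" using assms by (cases n) auto
  obtain k where k: "power_subgroup (group_of m Gs) n = pow_products (group_of m Gs) n k"
    using power_subgroup_width[OF assms] by blast
  have "(pow_products_formula m p k 0, undefined) \<in> formulas_over L A"
    using formula_in_pow_products_formula[OF L]
    by (simp add: formulas_over_def free_vars_pow_products_formula)
  moreover have "pow_products (group_of m Gs) n k =
      {x \<in> universe Gs. satisfies Gs x (pow_products_formula m p k 0, undefined)}"
    using sat_pow_products_formula[OF Gs.is_group] Gs.pow_products_carrier[of _ n k]
    by (auto simp: satisfies_def n)
  ultimately show ?thesis
    unfolding definable_def k by blast
qed

text \<open>The right-hand side is independent of \<open>A\<close>, which gives existence of the
  connected component. The index 0 is left out because zeroth powers generate the trivial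
  subgroup.\<close>

lemma connected_component_over_eq:
  "connected_component_over L m Gs A = (\<Inter>n\<in>{1..}. power_subgroup (group_of m Gs) n)"
proof
  show "connected_component_over L m Gs A \<subseteq> (\<Inter>n\<in>{1..}. power_subgroup (group_of m Gs) n)"
    using power_subgroup_finite_index power_subgroup_definable
    by (auto simp: connected_component_over_def)
  show "(\<Inter>n\<in>{1..}. power_subgroup (group_of m Gs) n) \<subseteq> connected_component_over L m Gs A"
    unfolding connected_component_over_def
    using Gs.finite_index_contains_power_subgroup by fastforce
qed

text \<open>Saturation reduces the claim to finding, for each \<open>N\<close>, an \<open>n\<close>-th root of \<open>g\<close> that is itself an
  \<open>N\<close>-th power, that is, an \<open>N n\<close>-th root of \<open>g\<close>.\<close>

lemma divisible_connected_component:
  assumes \<kappa>: "sufficiently_large L \<kappa>" and sat: "saturated L \<kappa> Gs"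
    and g: "g \<in> (\<Inter>N\<in>{1..}. power_subgroup (group_of m Gs) N)" and n: "n \<ge> 1"
  shows "\<exists>x\<in>(\<Inter>N\<in>{1..}. power_subgroup (group_of m Gs) N). x [^]\<^bsub>group_of m Gs\<^esub> (n::nat) = g"
proof -
  obtain p where p: "n = Suc p" using n by (cases n) auto
  have gG: "g \<in> universe Gs"
    using g subgroup.mem_carrier[OF Gs.power_subgroup_is_subgroup[of 1], of g] by auto
  obtain w where w: "\<And>N. N \<ge> 1 \<Longrightarrow> power_subgroup (group_of m Gs) N = pow_products (group_of m Gs) N (w N)"
    using power_subgroup_width by metis
  define root where "root = (Equal (pow_term m 0 p) (Variable 1) :: ('f, 'r) fo_formula, \<lambda>_::nat. g)"
  \<comment> \<open>Because of the shift, \<open>mem N\<close> concerns the exponent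
    \<open>Suc N\<close>.\<close>
  define mem where "mem N = (pow_products_formula m N (w (Suc N)) 0 :: ('f, 'r) fo_formula, \<lambda>_::nat. g)" for N
  have root: "satisfies Gs x root \<longleftrightarrow> x [^]\<^bsub>group_of m Gs\<^esub> n = g" if "x \<in> universe Gs" for x
    using that eval_pow_term[OF Gs.is_group, of "(\<lambda>_. g)(0 := x)" 0 p]
    by (simp add: satisfies_def root_def p del: nat_pow_Suc)
  have mem: "satisfies Gs x (mem N) \<longleftrightarrow> x \<in> power_subgroup (group_of m Gs) (Suc N)" if "x \<in> universe Gs" for x N
    using that sat_pow_products_formula[OF Gs.is_group, of "(\<lambda>_. g)(0 := x)" 0 N "w (Suc N)"] w[of "Suc N"]
    by (simp add: satisfies_def mem_def)
  define \<Gamma> where "\<Gamma> = insert root (range mem)"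
  have "is_type L Gs {g} \<Gamma>"
    unfolding is_type_def
  proof (intro conjI allI impI)
    show "\<Gamma> \<subseteq> formulas_over L {g}"
      using term_in_pow_term[OF L] formula_in_pow_products_formula[OF L]
      by (auto simp: \<Gamma>_def root_def mem_def formulas_over_def)
    fix \<Delta> assume "\<Delta> \<subseteq> \<Gamma>" "finite \<Delta>"
    then have "finite (\<Delta> - {root})" "\<Delta> - {root} \<subseteq> range mem" by (auto simp: \<Gamma>_def)
    then obtain I where I: "finite I" "\<Delta> - {root} = mem ` I"
      by (meson finite_subset_image)
    \<comment> \<open>A common multiple of the finitely many exponents in \<open>\<Delta>\<close>:
      an \<open>N\<close>-th power satisfies all those conditions at once.\<close>
    define N where "N = (\<Prod>i\<in>I. Suc i)"
    have N: "N \<ge> 1" using prod_pos[of I Suc] by (simp add: N_def Suc_le_eq)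
    \<comment> \<open>Since \<open>g\<close> lies in every \<open>power_subgroup\<close>, it has a
      root \<open>a\<close> of exponent \<open>N * n\<close>; then \<open>a [^] N\<close> is the
      required \<open>n\<close>-th root.\<close>
    obtain K where K: "K \<ge> 1"
      "power_subgroup (group_of m Gs) K \<subseteq> {a [^]\<^bsub>group_of m Gs\<^esub> (N * n) | a. a \<in> universe Gs}"
      using powers_of_power_subgroup[of "N * n"] N n by auto
    then obtain a where a: "a \<in> universe Gs" "g = a [^]\<^bsub>group_of m Gs\<^esub> (N * n)"
      using g by auto
    define x where "x = a [^]\<^bsub>group_of m Gs\<^esub> N"
    have x: "x \<in> universe Gs" using a Gs.nat_pow_closed[of a N] by (simp add: x_def)
    have xn: "x [^]\<^bsub>group_of m Gs\<^esub> n = g" using a Gs.nat_pow_pow[of a N n] by (simp add: x_def)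
    have xI: "x \<in> power_subgroup (group_of m Gs) (Suc i)" if "i \<in> I" for i
    proof -
      have "x \<in> power_subgroup (group_of m Gs) N"
        using a by (auto simp: x_def power_subgroup_def intro!: generate.incl)
      moreover have "Suc i dvd N" unfolding N_def using I(1) that by (rule dvd_prodI)
      ultimately show ?thesis using Gs.power_subgroup_dvd by blast
    qed
    have "\<forall>q\<in>\<Delta>. satisfies Gs x q"
    proof (intro ballI)
      fix q assume "q \<in> \<Delta>"
      then have "q = root \<or> q \<in> mem ` I" using I(2) by auto
      then show "satisfies Gs x q"
        using root[OF x] mem[OF x] xn xI by auto
    qed
    then show "\<exists>x\<in>universe Gs. \<forall>q\<in>\<Delta>. satisfies Gs x q" using x by blast
  qed
  moreover have "small \<kappa> {g}"
  proof -
    have "natLeq <o \<kappa>" using \<kappa> by (simp add: sufficiently_large_def)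
    moreover have "|{g}| <o natLeq" by (simp add: finite_iff_ordLess_natLeq[symmetric])
    ultimately show ?thesis unfolding small_def by (rule ordLess_transitive[rotated])
  qed
  ultimately obtain x where x: "x \<in> universe Gs" "\<forall>q\<in>\<Gamma>. satisfies Gs x q"
    using sat gG unfolding saturated_def by blast
  have "x [^]\<^bsub>group_of m Gs\<^esub> n = g" using x root by (auto simp: \<Gamma>_def)
  moreover have "x \<in> power_subgroup (group_of m Gs) N" if "N \<ge> 1" for N
    using x mem[OF x(1), of "N - 1"] that by (auto simp: \<Gamma>_def)
  ultimately show ?thesis by auto
qed

lemma connected_component_divisible:
  assumes "sufficiently_large L \<kappa>" "saturated L \<kappa> Gs"
  shows "divisible_group ((group_of m Gs)\<lparr>carrier := connected_component L m Gs\<rparr>)"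
proof -
  define C where "C = (\<Inter>n\<in>{1..}. power_subgroup (group_of m Gs) n)"
  have C: "connected_component L m Gs = C"
    by (simp add: connected_component_def connected_component_over_eq C_def)
  have "subgroup C (group_of m Gs)"
    unfolding C_def by (rule Gs.subgroups_Inter) (auto intro: Gs.power_subgroup_is_subgroup)
  then have "group ((group_of m Gs)\<lparr>carrier := C\<rparr>)"
    by (rule Gs.subgroup_imp_group)
  then show ?thesis
    using divisible_connected_component[OF assms]
    unfolding C divisible_group_def by (simp add: C_def flip: Gs.nat_pow_consistent)
qed

end

theorem theorem3p8:
  fixes L :: "('f, 'r) language"
    and m :: 'f
    and G Gs :: "('a, 'f, 'r) fo_struct"
    and \<kappa> :: "'k rel"
  assumes "expands_group_language L m"
    and "is_structure L G"
    and "group (group_of m G)"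
    and "infinite (carrier (group_of m G))"
    and "finitely_generated (group_of m G)"
    and "virtually_nilpotent (group_of m G)"
    and "elementary_extension L G Gs"
    and "sufficiently_large L \<kappa>"
    and "saturated L \<kappa> Gs"
    and "strongly_homogeneous L \<kappa> Gs"
  shows "connected_component_exists L m \<kappa> Gs \<and>
    divisible_group ((group_of m Gs)\<lparr>carrier := connected_component L m Gs\<rparr>) \<and>
    connected_component L m Gs = (\<Inter>n\<in>{1..}. power_subgroup (group_of m Gs) n)"
proof -
  interpret elementary_power_extension L m G Gs
    by (intro elementary_power_extension.intro assms)
  show ?thesis
    using connected_component_divisible[OF assms(8,9)] connected_component_over_eq
    by (simp add: connected_component_exists_def connected_component_def)
qed

end
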